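(* The function $$u(x,y,t)=2\frac{\partial}{\partial x}\int_\Omega E(p,q,x,y,t)\,\psi(p,q,x,y,t)\,g(p,q)\,dp\,dq,\qquad (x,y,t)\in\mathbb{R}^3,$$ is a solution of the KP-I equation $$\frac{\partial}{\partial x}\Bigl(u_t+\tfrac32uu_x+\tfrac14u_{xxx}\Bigr)-\tfrac34u_{yy}=0 .$$ It is a real solution, and it vanishes as $x\to-\infty$.
   Context: Points of $\mathbb{C}\cong\mathbb{R}^2$ are written $k=p+iq$ and $\lambda=\mu+i\nu$. $\Omega\subset\mathbb{C}$ is a domain with smooth boundary, located in the right half plane $\{\operatorname{Re}k>0\}$ at positive distance from the imaginary axis. $g$ is a smooth positive function on $\overline\Omega$; if $\Omega$ is unbounded, $g$ satisfies in addition $$\int_\Omega e^{c\mu(\mu^2+\nu^2)}g(\mu,\nu)\,d\mu\,d\nu<\infty\quad\text{for every }c>0 .$$ For $x,y,t\in\mathbb{R}$ put $$E(p,q)=E(p,q,x,y,t)=e^{p(x-f(p,q,Y)t)},\qquad f(p,q,Y)=p^2-3q^2-2qY,\quad Y=y/t,$$ i.e. $E=e^{p(x-(p^2-3q^2)t+2qy)}$. $L^2_g(\Omega)$ is the Hilbert space of complex valued functions on $\Omega$ with norm $\|\varphi\|=\bigl(\int_\Omega|\varphi|^2g\,d\mu\,d\nu\bigr)^{1/2}$. $\psi(p,q)=\psi(p,q,x,y,t)$ is the unique solution in $L^2_g(\Omega)$ of $$\psi(p,q)+\int_\Omega\frac{E(p,q)E(\mu,\nu)}{\lambda+\overline k}\,\psi(\mu,\nu)\,g(\mu,\nu)\,d\mu\,d\nu=E(p,q),\qquad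 k=p+iq\in\Omega;$$ it depends in a $C^\infty$ way on $(x,y,t)$. *)

theory Defs
  imports "HOL-Analysis.Analysis"
begin

section \<open>Smooth functions and smooth domains\<close>

text \<open>\<open>Ck_on n S f\<close> is meant for open \<open>S\<close>, where the Frechet derivative is unique.\<close>

primrec Ck_on ::
  "nat \<Rightarrow> 'a::euclidean_space set \<Rightarrow> ('a \<Rightarrow> 'b::real_normed_vector) \<Rightarrow> bool" where
  "Ck_on 0 S f \<longleftrightarrow> continuous_on S f"
| "Ck_on (Suc n) S f \<longleftrightarrow>
     (\<forall>x\<in>S. f differentiable (at x)) \<and>
     (\<forall>v. Ck_on n S (\<lambda>x. frechet_derivative f (at x) v))"

definition smooth_on ::
  "'a::euclidean_space set \<Rightarrow> ('a \<Rightarrow> 'b::real_normed_vector) \<Rightarrow> bool" where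
  "smooth_on S f \<longleftrightarrow> (\<forall>n. Ck_on n S f)"

text \<open>Smoothness up to the boundary: \<open>f\<close> agrees on \<open>A\<close> with a function that is smooth
  on an open neighbourhood of \<open>A\<close>.\<close>

definition smooth_on_closed ::
  "'a::euclidean_space set \<Rightarrow> ('a \<Rightarrow> 'b::real_normed_vector) \<Rightarrow> bool" where
  "smooth_on_closed A f \<longleftrightarrow>
     (\<exists>U h. open U \<and> A \<subseteq> U \<and> smooth_on U h \<and> (\<forall>z\<in>A. f z = h z))"

text \<open>Near each boundary point \<open>D\<close> is the sublevel set of a smooth defining function with
  nonvanishing differential; in particular \<open>D\<close> lies locally on one side of its boundary.\<close>

definition smooth_boundary :: "complex set \<Rightarrow> bool" where
  "smooth_boundary D \<longleftrightarrow>
     (\<forall>z\<in>frontier D. \<exists>U (\<rho>::complex \<Rightarrow> real).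
        open U \<and> z \<in> U \<and> smooth_on U \<rho> \<and>
        (\<exists>v. frechet_derivative \<rho> (at z) v \<noteq> 0) \<and>
        D \<inter> U = {w\<in>U. \<rho> w < 0})"

definition admissible_domain :: "complex set \<Rightarrow> bool" where
  "admissible_domain \<Omega> \<longleftrightarrow>
     open \<Omega> \<and> connected \<Omega> \<and> \<Omega> \<noteq> {} \<and> smooth_boundary \<Omega> \<and>
     (\<forall>k\<in>\<Omega>. 0 < Re k) \<and> 0 < setdist \<Omega> {k. Re k = 0}"

text \<open>Finiteness of the integral is integrability, the integrand being nonnegative and
  measurable.\<close>

definition admissible_weight :: "complex set \<Rightarrow> (complex \<Rightarrow> real) \<Rightarrow> bool" where
  "admissible_weight \<Omega> g \<longleftrightarrow>
     smooth_on_closed (closure \<Omega>) g \<and> (\<forall>k\<in>closure \<Omega>. 0 < g k) \<and>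
     (\<not> bounded \<Omega> \<longrightarrow>
        (\<forall>c>0. integrable (lebesgue_on \<Omega>)
           (\<lambda>l. exp (c * Re l * ((Re l)\<^sup>2 + (Im l)\<^sup>2)) * g l)))"


section \<open>The integral equation\<close>

text \<open>The exponent is \<open>p (x - f(p,q,y/t) t)\<close> with \<open>f(p,q,Y) = p\<^sup>2 - 3 q\<^sup>2 - 2 q Y\<close>, multiplied
  out so that it also makes sense for \<open>t = 0\<close>.\<close>

definition E :: "complex \<Rightarrow> real \<Rightarrow> real \<Rightarrow> real \<Rightarrow> real" where
  "E k x y t =
     exp (Re k * (x - ((Re k)\<^sup>2 - 3 * (Im k)\<^sup>2) * t + 2 * Im k * y))"

definition in_L2 :: "complex set \<Rightarrow> (complex \<Rightarrow> real) \<Rightarrow> (complex \<Rightarrow> complex) \<Rightarrow> bool" where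
  "in_L2 \<Omega> g \<phi> \<longleftrightarrow>
     \<phi> \<in> borel_measurable (lebesgue_on \<Omega>) \<and>
     integrable (lebesgue_on \<Omega>) (\<lambda>k. (cmod (\<phi> k))\<^sup>2 * g k)"

text \<open>The integral equation is one between elements of the weighted \<open>L\<^sup>2\<close> space, hence holds
  for almost every \<open>k\<close>.\<close>

definition solves_integral_equation ::
  "complex set \<Rightarrow> (complex \<Rightarrow> real) \<Rightarrow> real \<Rightarrow> real \<Rightarrow> real \<Rightarrow> (complex \<Rightarrow> complex) \<Rightarrow> bool" where
  "solves_integral_equation \<Omega> g x y t \<phi> \<longleftrightarrow>
     in_L2 \<Omega> g \<phi> \<and>
     (AE k in lebesgue_on \<Omega>.
        \<phi> k + (LINT l|lebesgue_on \<Omega>.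
                 complex_of_real (E k x y t * E l x y t) / (l + cnj k)
                   * \<phi> l * complex_of_real (g l))
          = complex_of_real (E k x y t))"


section \<open>The KP-I equation\<close>

definition Dx :: "(real \<Rightarrow> real \<Rightarrow> real \<Rightarrow> complex) \<Rightarrow> real \<Rightarrow> real \<Rightarrow> real \<Rightarrow> complex" where
  "Dx v x y t = vector_derivative (\<lambda>s. v s y t) (at x)"

definition Dy :: "(real \<Rightarrow> real \<Rightarrow> real \<Rightarrow> complex) \<Rightarrow> real \<Rightarrow> real \<Rightarrow> real \<Rightarrow> complex" where
  "Dy v x y t = vector_derivative (\<lambda>s. v x s t) (at y)"

definition Dt :: "(real \<Rightarrow> real \<Rightarrow> real \<Rightarrow> complex) \<Rightarrow> real \<Rightarrow> real \<Rightarrow> real \<Rightarrow> complex" where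
  "Dt v x y t = vector_derivative (\<lambda>s. v x y s) (at t)"

text \<open>Classical solutions on all of space-time; smoothness guarantees that every derivative
  in the equation exists.\<close>

definition KP_I_solution :: "(real \<Rightarrow> real \<Rightarrow> real \<Rightarrow> complex) \<Rightarrow> bool" where
  "KP_I_solution u \<longleftrightarrow>
     smooth_on UNIV (\<lambda>(x, y, t). u x y t) \<and>
     (\<forall>x y t.
        Dx (\<lambda>x y t. Dt u x y t + 3/2 * u x y t * Dx u x y t + 1/4 * Dx (Dx (Dx u)) x y t) x y t
          - 3/4 * Dy (Dy u) x y t = 0)"

definition KP_potential ::
  "complex set \<Rightarrow> (complex \<Rightarrow> real) \<Rightarrow> (real \<Rightarrow> real \<Rightarrow> real \<Rightarrow> complex \<Rightarrow> complex)
     \<Rightarrow> real \<Rightarrow> real \<Rightarrow> real \<Rightarrow> complex" where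
  "KP_potential \<Omega> g \<psi> x y t =
     (LINT k|lebesgue_on \<Omega>. complex_of_real (E k x y t) * \<psi> x y t k * complex_of_real (g k))"

end

theory Submission
  imports Defs
begin

text \<open>
  Put \<open>\<theta>(l) = x l - i y l\<^sup>2 - t l\<^sup>3\<close>, so that \<open>E = |exp \<theta>|\<close>. Multiplying \<open>\<psi>\<close> by the unimodular factor
  \<open>exp (- i Im \<theta>)\<close> replaces the kernel \<open>E(k) E(l) / (l + cnj k)\<close> by
  \<open>exp (cnj (\<theta>(k)) + \<theta>(l)) / (l + cnj k)\<close>, whose derivatives in \<open>x\<close>, \<open>y\<close>, \<open>t\<close> have finite rank because
  \<open>\<theta>(l) + cnj (\<theta>(k))\<close> is divisible by \<open>l + cnj k\<close>. The corresponding operator \<open>K\<close> on \<open>L\<^sup>2\<close> is Hermitian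
  and positive, so \<open>1 + K\<close> has an inverse \<open>R\<close> of norm at most one. The functions
  \<open>W n m = \<langle>cnj l\<^sup>n exp (cnj \<theta>), R (cnj l\<^sup>m exp (cnj \<theta>))\<rangle>\<close> of \<open>(x, y, t)\<close> then form a closed system: each first-order
  derivative of \<open>W n m\<close> is a quadratic polynomial in such functions. This gives smoothness, and since
  \<open>u = 2 \<partial>\<^sub>x W 0 0\<close>, it reduces the KP-I equation to a polynomial identity in the \<open>W n m\<close>. Moreover
  \<open>cnj (W n m) = W m n\<close>, and \<open>|W n m|\<close> is at most the product of two \<open>L\<^sup>2\<close> norms that decay
  exponentially as \<open>x\<close> tends to \<open>-\<infinity>\<close>.
\<close>

section \<open>Square-integrable functions and functions of moderate growth\<close>

text \<open>Derivatives in the parameters bring down powers of \<open>l\<close>, which are unbounded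
  on an unbounded domain, while the weight controls only exponentials of \<open>Re l |l|^2\<close>;
  the exponential of \<open>|l|^3\<close> need not be integrable. The class of functions bounded by
  some \<open>C * exp (c * wt l)\<close> copes with this: it is an algebra inside
  \<open>L\<^sup>2\<close> that contains all waves and all powers of \<open>l\<close>. An explicit
  iteration yields solutions within this class, valid at every point and not merely almost
  everywhere.

  Nothing is known beforehand about the regularity of the solution in \<open>(x, y, t)\<close>, and
  it is never differentiated. Symmetry gives a formula for the increments of \<open>W\<close> in
  which only the data are differenced; a Lipschitz bound for the solution, which coercivity
  supplies, then suffices for a quadratic remainder.

  Positivity of the kernel comes from recognising \<open>1 / (l + cnj k)\<close> as a multiple of
  the Szego kernel of the right half plane, expanded by way of the disc.

  The polynomial identity is proved for the potential \<open>v = W 0 0\<close>, that is, for the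
  equation integrated once in \<open>x\<close>; commuting partial derivatives then give KP-I for
  \<open>2 v_x\<close>.\<close>

lemma measurable_cnj [measurable]: "cnj \<in> borel_measurable borel"
  by (intro borel_measurable_continuous_onI continuous_intros)

definition square_integrable :: "'a measure \<Rightarrow> ('a \<Rightarrow> complex) \<Rightarrow> bool" where
  "square_integrable M f \<longleftrightarrow> f \<in> borel_measurable M \<and> integrable M (\<lambda>x. (cmod (f x))\<^sup>2)"

definition L2norm :: "'a measure \<Rightarrow> ('a \<Rightarrow> complex) \<Rightarrow> real" where
  "L2norm M f = sqrt (\<integral>x. (cmod (f x))\<^sup>2 \<partial>M)"

lemma square_integrable_measurable [measurable_dest]:
  "square_integrable M f \<Longrightarrow> f \<in> borel_measurable M"
  by (simp add: square_integrable_def)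

lemma L2norm_nonneg [simp]: "0 \<le> L2norm M f"
  by (simp add: L2norm_def)

lemma L2norm_power2: "(L2norm M f)\<^sup>2 = (\<integral>x. (cmod (f x))\<^sup>2 \<partial>M)"
  by (simp add: L2norm_def)

lemma square_integrable_mult:
  assumes "square_integrable M f" "square_integrable M h"
  shows "integrable M (\<lambda>x. f x * h x)"
proof (rule Bochner_Integration.integrable_bound)
  show "integrable M (\<lambda>x. (cmod (f x))\<^sup>2 + (cmod (h x))\<^sup>2)"
    using assms by (auto simp: square_integrable_def)
  show "(\<lambda>x. f x * h x) \<in> borel_measurable M"
    using assms by (auto simp: square_integrable_def)
  have "a * b \<le> a\<^sup>2 + b\<^sup>2" if "0 \<le> a" "0 \<le> b" for a b :: real
    using sum_squares_bound[of a b] mult_nonneg_nonneg[OF that] by linarith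
  then show "AE x in M. norm (f x * h x) \<le> norm ((cmod (f x))\<^sup>2 + (cmod (h x))\<^sup>2)"
    by (intro AE_I2) (simp add: norm_mult)
qed

lemma square_integrable_mult_norm:
  assumes "square_integrable M f" "square_integrable M h"
  shows "integrable M (\<lambda>x. cmod (f x) * cmod (h x))"
  using integrable_norm[OF square_integrable_mult[OF assms]] by (simp add: norm_mult)

lemma Cauchy_Schwarz_L2_norm:
  assumes "square_integrable M f" "square_integrable M h"
  shows "(\<integral>x. cmod (f x) * cmod (h x) \<partial>M) \<le> L2norm M f * L2norm M h"
proof -
  define A B C where "A = (\<integral>x. (cmod (f x))\<^sup>2 \<partial>M)" and "B = (\<integral>x. (cmod (h x))\<^sup>2 \<partial>M)"
    and "C = (\<integral>x. cmod (f x) * cmod (h x) \<partial>M)"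
  note [simp] = square_integrable_mult_norm[OF assms]
  have [simp]: "integrable M (\<lambda>x. (cmod (f x))\<^sup>2)" "integrable M (\<lambda>x. (cmod (h x))\<^sup>2)"
    using assms by (auto simp: square_integrable_def)
  have nn: "0 \<le> A" "0 \<le> B" "0 \<le> C"
    by (simp_all add: A_def B_def C_def)
  have *: "0 \<le> s\<^sup>2 * A - 2 * s * C + B" for s
  proof -
    have "0 \<le> (\<integral>x. (s * cmod (f x) - cmod (h x))\<^sup>2 \<partial>M)"
      by simp
    also have "\<dots> = (\<integral>x. s\<^sup>2 * (cmod (f x))\<^sup>2 - 2 * s * (cmod (f x) * cmod (h x)) + (cmod (h x))\<^sup>2 \<partial>M)"
      by (rule Bochner_Integration.integral_cong) (auto simp: power2_eq_square algebra_simps)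
    also have "\<dots> = s\<^sup>2 * A - 2 * s * C + B"
      by (simp add: A_def B_def C_def)
    finally show ?thesis .
  qed
  have "C\<^sup>2 \<le> A * B"
  proof (cases "A = 0")
    case True
    have "C = 0"
    proof (rule ccontr)
      assume "C \<noteq> 0"
      \<comment> \<open>For \<open>A = 0\<close> the quadratic in \<open>s\<close> is affine and
        takes the value \<open>- 1\<close> at this point. For positive \<open>A\<close> the case
        below evaluates it at its minimiser \<open>C / A\<close>.\<close>
      with *[of "(B + 1) / (2 * C)"] True show False by (simp add: field_simps)
    qed
    with nn show ?thesis by simp
  next
    case False
    with nn have "A > 0" by simp
    with *[of "C / A"] show ?thesis by (simp add: field_simps power2_eq_square)
  qed
  then have "C \<le> sqrt (A * B)"
    using nn by (simp add: real_le_rsqrt)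
  then show ?thesis
    by (simp add: A_def B_def C_def L2norm_def real_sqrt_mult)
qed

lemma Cauchy_Schwarz_L2:
  assumes "square_integrable M f" "square_integrable M h"
  shows "cmod (\<integral>x. f x * h x \<partial>M) \<le> L2norm M f * L2norm M h"
proof -
  have "cmod (\<integral>x. f x * h x \<partial>M) \<le> (\<integral>x. cmod (f x * h x) \<partial>M)"
    by (rule integral_norm_bound)
  with Cauchy_Schwarz_L2_norm[OF assms] show ?thesis by (simp add: norm_mult)
qed

lemma square_integrable_bound:
  assumes "square_integrable M h" "f \<in> borel_measurable M"
    and le: "\<And>x. x \<in> space M \<Longrightarrow> cmod (f x) \<le> c * cmod (h x)"
  shows "square_integrable M f"
  unfolding square_integrable_def
proof
  show "integrable M (\<lambda>x. (cmod (f x))\<^sup>2)"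
  proof (rule Bochner_Integration.integrable_bound)
    show "integrable M (\<lambda>x. c\<^sup>2 * (cmod (h x))\<^sup>2)"
      using assms(1) by (simp add: square_integrable_def)
    have "(cmod (f x))\<^sup>2 \<le> (c * cmod (h x))\<^sup>2" if "x \<in> space M" for x
      using le[OF that] by (intro power_mono) auto
    then show "AE x in M. norm ((cmod (f x))\<^sup>2) \<le> norm (c\<^sup>2 * (cmod (h x))\<^sup>2)"
      by (intro AE_I2) (auto simp: power_mult_distrib)
  qed (use assms(2) in measurable)
qed fact

lemma L2norm_bound:
  assumes "square_integrable M h" "f \<in> borel_measurable M" "0 \<le> c"
    and le: "\<And>x. x \<in> space M \<Longrightarrow> cmod (f x) \<le> c * cmod (h x)"
  shows "L2norm M f \<le> c * L2norm M h"
proof -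
  have "(\<integral>x. (cmod (f x))\<^sup>2 \<partial>M) \<le> (\<integral>x. c\<^sup>2 * (cmod (h x))\<^sup>2 \<partial>M)"
  proof (rule integral_mono)
    show "integrable M (\<lambda>x. (cmod (f x))\<^sup>2)"
      using square_integrable_bound[OF assms(1,2) le] by (simp add: square_integrable_def)
    show "integrable M (\<lambda>x. c\<^sup>2 * (cmod (h x))\<^sup>2)"
      using assms(1) by (simp add: square_integrable_def)
    show "(cmod (f x))\<^sup>2 \<le> c\<^sup>2 * (cmod (h x))\<^sup>2" if "x \<in> space M" for x
      using power_mono[OF le[OF that], of 2] by (simp add: power_mult_distrib)
  qed
  then have "L2norm M f \<le> sqrt (c\<^sup>2 * (\<integral>x. (cmod (h x))\<^sup>2 \<partial>M))"
    unfolding L2norm_def by (subst (asm) integral_mult_right_zero) (rule real_sqrt_le_mono)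
  then show ?thesis
    using \<open>0 \<le> c\<close> by (simp add: L2norm_def real_sqrt_mult)
qed

lemma square_integrable_add:
  assumes "square_integrable M f" "square_integrable M h"
  shows "square_integrable M (\<lambda>x. f x + h x)"
  unfolding square_integrable_def
proof
  show "integrable M (\<lambda>x. (cmod (f x + h x))\<^sup>2)"
  proof (rule Bochner_Integration.integrable_bound)
    show "integrable M (\<lambda>x. 2 * (cmod (f x))\<^sup>2 + 2 * (cmod (h x))\<^sup>2)"
      using assms by (simp add: square_integrable_def)
    have "(cmod (a + b))\<^sup>2 \<le> 2 * (cmod a)\<^sup>2 + 2 * (cmod b)\<^sup>2" for a b
    proof -
      have "(cmod (a + b))\<^sup>2 \<le> (cmod a + cmod b)\<^sup>2"
        by (intro power_mono norm_triangle_ineq) auto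
      then show ?thesis
        using sum_squares_bound[of "cmod a" "cmod b"] by (simp add: power2_sum)
    qed
    then show "AE x in M. norm ((cmod (f x + h x))\<^sup>2) \<le> norm (2 * (cmod (f x))\<^sup>2 + 2 * (cmod (h x))\<^sup>2)"
      by (intro AE_I2) auto
  qed (use assms in \<open>auto simp: square_integrable_def\<close>)
qed (use assms in \<open>auto simp: square_integrable_def\<close>)

lemma square_integrable_cmult:
  "square_integrable M f \<Longrightarrow> square_integrable M (\<lambda>x. c * f x)"
  by (auto simp: square_integrable_def norm_mult power_mult_distrib)

lemma square_integrable_diff:
  "square_integrable M f \<Longrightarrow> square_integrable M h \<Longrightarrow> square_integrable M (\<lambda>x. f x - h x)"
  using square_integrable_add[of M f "\<lambda>x. - 1 * h x"] square_integrable_cmult[of M h "- 1"] by simp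

lemma square_integrable_cnj:
  "square_integrable M f \<Longrightarrow> square_integrable M (\<lambda>x. cnj (f x))"
  by (auto simp: square_integrable_def)

lemma L2norm_cnj [simp]: "L2norm M (\<lambda>x. cnj (f x)) = L2norm M f"
  by (simp add: L2norm_def)

lemma (in finite_measure) square_integrable_integrable:
  assumes "square_integrable M f"
  shows "integrable M f"
  using square_integrable_mult[OF assms, of "\<lambda>_. 1"] by (simp add: square_integrable_def)

section \<open>The growth weight, the phases and the functions of moderate growth\<close>

definition wt :: "complex \<Rightarrow> real" where
  "wt l = Re l * (cmod l)\<^sup>2"

definition phase :: "real \<times> real \<times> real \<Rightarrow> complex \<Rightarrow> complex" where
  "phase = (\<lambda>(x, y, t) l. of_real x * l - \<i> * of_real y * l\<^sup>2 - of_real t * l ^ 3)"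

lemma phase_add: "phase (s + d) l = phase s l + phase d l"
  by (cases s; cases d) (simp add: phase_def algebra_simps)

definition wave :: "real \<times> real \<times> real \<Rightarrow> complex \<Rightarrow> complex" where
  "wave s l = exp (phase s l)"

text \<open>\<open>N\<close> stands for the measure \<open>g dp dq\<close> on the domain, so that
  weighted integrals become plain ones. Domain and weight enter the analysis through these
  assumptions; \<open>exp_wt_integrable\<close> is meant for every real \<open>c\<close>.\<close>

locale kp_measure = finite_measure N for N :: "complex measure" +
  fixes \<delta> :: real
  assumes id_measurable [measurable]: "(\<lambda>l. l) \<in> borel_measurable N"
    and \<delta>_pos: "0 < \<delta>"
    and Re_ge: "l \<in> space N \<Longrightarrow> \<delta> \<le> Re l"
    and exp_wt_integrable: "integrable N (\<lambda>l. exp (c * wt l))"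
begin

lemma cmod_ge: "l \<in> space N \<Longrightarrow> \<delta> \<le> cmod l"
  using Re_ge complex_Re_le_cmod order_trans by blast

lemma wt_ge: "l \<in> space N \<Longrightarrow> \<delta> * (cmod l)\<^sup>2 \<le> wt l"
  by (simp add: wt_def Re_ge mult_right_mono)

lemma wt_ge': "l \<in> space N \<Longrightarrow> \<delta>\<^sup>2 * cmod l \<le> wt l"
proof -
  assume l: "l \<in> space N"
  have "\<delta> * (\<delta> * cmod l) \<le> \<delta> * (cmod l * cmod l)"
    using \<delta>_pos cmod_ge[OF l] by (intro mult_left_mono mult_right_mono) auto
  with wt_ge[OF l] show ?thesis by (simp add: power2_eq_square mult.assoc)
qed

lemma wt_nonneg: "l \<in> space N \<Longrightarrow> 0 \<le> wt l"
  using Re_ge[of l] \<delta>_pos by (simp add: wt_def)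

lemma wt_measurable [measurable]: "wt \<in> borel_measurable N"
  unfolding wt_def[abs_def] by measurable

text \<open>The constant \<open>c\<close> is free, so products stay in the class, and since
  exponentials of every multiple of \<open>wt\<close> are integrable, each member is square
  integrable.\<close>

definition moderate :: "(complex \<Rightarrow> complex) \<Rightarrow> bool" where
  "moderate f \<longleftrightarrow> f \<in> borel_measurable N \<and> (\<exists>C c. \<forall>l\<in>space N. cmod (f l) \<le> C * exp (c * wt l))"

lemma moderate_measurable [measurable_dest]: "moderate f \<Longrightarrow> f \<in> borel_measurable N"
  by (simp add: moderate_def)

lemma moderateE:
  assumes "moderate f"
  obtains C c where "0 \<le> C" "0 \<le> c" "\<forall>l\<in>space N. cmod (f l) \<le> C * exp (c * wt l)"
proof -
  obtain C c where *: "\<And>l. l \<in> space N \<Longrightarrow> cmod (f l) \<le> C * exp (c * wt l)"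
    using assms unfolding moderate_def by blast
  have "cmod (f l) \<le> \<bar>C\<bar> * exp (\<bar>c\<bar> * wt l)" if "l \<in> space N" for l
  proof -
    have "C * exp (c * wt l) \<le> \<bar>C\<bar> * exp (\<bar>c\<bar> * wt l)"
      using wt_nonneg[OF that] by (intro mult_mono) (auto intro: mult_right_mono)
    with *[OF that] show ?thesis by simp
  qed
  then show ?thesis by (intro that[of "\<bar>C\<bar>" "\<bar>c\<bar>"]) auto
qed

lemma moderateI:
  assumes "f \<in> borel_measurable N" "\<And>l. l \<in> space N \<Longrightarrow> cmod (f l) \<le> C * exp (c * wt l)"
  shows "moderate f"
  using assms unfolding moderate_def by blast

lemma moderate_mult [intro]:
  assumes "moderate f" "moderate h"
  shows "moderate (\<lambda>l. f l * h l)"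
proof -
  obtain C c where f: "0 \<le> C" "0 \<le> c" "\<forall>l\<in>space N. cmod (f l) \<le> C * exp (c * wt l)"
    by (rule moderateE[OF assms(1)])
  obtain C' c' where h: "0 \<le> C'" "0 \<le> c'" "\<forall>l\<in>space N. cmod (h l) \<le> C' * exp (c' * wt l)"
    by (rule moderateE[OF assms(2)])
  show ?thesis
  proof (rule moderateI)
    fix l assume l: "l \<in> space N"
    have "cmod (f l * h l) \<le> (C * exp (c * wt l)) * (C' * exp (c' * wt l))"
      unfolding norm_mult using f(1) h(1) by (intro mult_mono f(3)[rule_format] h(3)[rule_format] l) auto
    then show "cmod (f l * h l) \<le> (C * C') * exp ((c + c') * wt l)"
      by (simp add: exp_add algebra_simps)
  qed (use assms in measurable)
qed

lemma moderate_add [intro]: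
  assumes "moderate f" "moderate h"
  shows "moderate (\<lambda>l. f l + h l)"
proof -
  obtain C c where f: "0 \<le> C" "0 \<le> c" "\<forall>l\<in>space N. cmod (f l) \<le> C * exp (c * wt l)"
    by (rule moderateE[OF assms(1)])
  obtain C' c' where h: "0 \<le> C'" "0 \<le> c'" "\<forall>l\<in>space N. cmod (h l) \<le> C' * exp (c' * wt l)"
    by (rule moderateE[OF assms(2)])
  show ?thesis
  proof (rule moderateI)
    fix l assume l: "l \<in> space N"
    have "cmod (f l + h l) \<le> C * exp (c * wt l) + C' * exp (c' * wt l)"
      by (intro norm_triangle_le add_mono f(3)[rule_format] h(3)[rule_format] l)
    also have "\<dots> \<le> C * exp ((c + c') * wt l) + C' * exp ((c + c') * wt l)"
      using f(1,2) h(1,2) wt_nonneg[OF l] by (intro add_mono mult_left_mono) (auto intro: mult_right_mono)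
    finally show "cmod (f l + h l) \<le> (C + C') * exp ((c + c') * wt l)"
      by (simp add: algebra_simps)
  qed (use assms in measurable)
qed

lemma moderate_const [intro, simp]: "moderate (\<lambda>_. c)"
  by (rule moderateI[of _ "cmod c" 0]) auto

lemma moderate_cnj [intro]: "moderate f \<Longrightarrow> moderate (\<lambda>l. cnj (f l))"
  unfolding moderate_def by auto

lemma moderate_id [intro, simp]: "moderate (\<lambda>l. l)"
proof (rule moderateI)
  fix l assume "l \<in> space N"
  from wt_ge'[OF this] \<delta>_pos have "cmod l \<le> 1 / \<delta>\<^sup>2 * wt l"
    by (simp add: field_simps)
  also have "\<dots> \<le> exp (1 / \<delta>\<^sup>2 * wt l)"
    using exp_ge_add_one_self[of "1 / \<delta>\<^sup>2 * wt l"] by linarith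
  finally show "cmod l \<le> 1 * exp (1 / \<delta>\<^sup>2 * wt l)" by simp
qed measurable

lemma moderate_uminus [intro]: "moderate f \<Longrightarrow> moderate (\<lambda>l. - f l)"
  unfolding moderate_def by auto

lemma moderate_diff [intro]: "moderate f \<Longrightarrow> moderate h \<Longrightarrow> moderate (\<lambda>l. f l - h l)"
  using moderate_add[of f "\<lambda>l. - h l"] by auto

lemma moderate_power [intro]: "moderate f \<Longrightarrow> moderate (\<lambda>l. f l ^ n)"
  by (induction n) auto

lemma moderate_square_integrable:
  assumes "moderate f"
  shows "square_integrable N f"
proof -
  obtain C c where f: "0 \<le> C" "0 \<le> c" "\<forall>l\<in>space N. cmod (f l) \<le> C * exp (c * wt l)"
    by (rule moderateE[OF assms])
  have "square_integrable N (\<lambda>l. of_real (exp (c * wt l)))"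
    using exp_wt_integrable[of "2 * c"]
    by (auto simp: square_integrable_def power2_eq_square algebra_simps simp flip: exp_add)
  then show ?thesis
    by (rule square_integrable_bound[where c = C]) (use f moderate_measurable[OF assms] in auto)
qed

lemma moderate_integrable: "moderate f \<Longrightarrow> integrable N f"
  by (simp add: moderate_square_integrable square_integrable_integrable)

text \<open>The summands are the constants in the bounds for the coefficients of \<open>x\<close>,
  \<open>y\<close> and \<open>t\<close> in the real part of the phase, each compared with
  \<open>wt\<close>.\<close>

definition B :: real where "B = 1 / \<delta>\<^sup>2 + 2 / \<delta> + 3"

lemma B_pos: "0 < B"
  using \<delta>_pos by (simp add: B_def add_pos_pos)

text \<open>Every term of \<open>Re (phase d l)\<close> has a factor \<open>Re l\<close> and total
  degree at most three, so \<open>wt l\<close> dominates it once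
  \<open>\<delta> \<le> cmod l\<close> has supplied the missing powers. The imaginary part admits no
  such bound.\<close>

lemma abs_Re_phase_le:
  assumes l: "l \<in> space N"
  shows "\<bar>Re (phase d l)\<bar> \<le> B * norm d * wt l"
proof -
  obtain x y t where d: "d = (x, y, t)" by (cases d)
  have nx: "\<bar>x\<bar> \<le> norm d" and ny: "\<bar>y\<bar> \<le> norm d" and nt: "\<bar>t\<bar> \<le> norm d"
    using norm_fst_le[of x "(y, t)"] norm_snd_le[of "(y, t)" x] norm_fst_le[of y t] norm_snd_le[of t y]
    by (auto simp: d)
  define p q where "p = Re l" and "q = Im l"
  have p: "0 < p" using Re_ge[OF l] \<delta>_pos by (simp add: p_def)
  have lpq: "(cmod l)\<^sup>2 = p\<^sup>2 + q\<^sup>2" by (simp add: p_def q_def cmod_power2)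
  have wt: "wt l = p * (p\<^sup>2 + q\<^sup>2)" unfolding lpq[symmetric] by (simp add: wt_def p_def)
  have Re: "Re (phase d l) = p * x + (2 * p * q) * y - (p * (p\<^sup>2 - 3 * q\<^sup>2)) * t"
    by (simp add: d phase_def p_def q_def power2_eq_square power3_eq_cube algebra_simps)
  have 1: "p \<le> wt l / \<delta>\<^sup>2"
  proof -
    have "p * \<delta>\<^sup>2 \<le> p * (cmod l)\<^sup>2"
      using p cmod_ge[OF l] \<delta>_pos by (intro mult_left_mono power_mono) auto
    then show ?thesis using \<delta>_pos by (simp add: wt_def p_def field_simps)
  qed
  have 2: "\<bar>2 * p * q\<bar> \<le> 2 * wt l / \<delta>"
  proof -
    have "\<bar>q\<bar> * \<delta> \<le> cmod l * cmod l"
      using cmod_ge[OF l] abs_Im_le_cmod[of l] \<delta>_pos by (intro mult_mono) (auto simp: q_def)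
    then have "p * (\<bar>q\<bar> * \<delta>) \<le> wt l"
      using p by (auto simp: wt_def p_def power2_eq_square intro!: mult_left_mono)
    then show ?thesis using \<delta>_pos p by (simp add: field_simps abs_mult)
  qed
  have 3: "\<bar>p * (p\<^sup>2 - 3 * q\<^sup>2)\<bar> \<le> 3 * wt l"
  proof -
    have "\<bar>p\<^sup>2 - 3 * q\<^sup>2\<bar> \<le> 3 * (p\<^sup>2 + q\<^sup>2)" by (auto simp: abs_if)
    then show ?thesis using p by (simp add: abs_mult wt)
  qed
  have "\<bar>Re (phase d l)\<bar> \<le> p * \<bar>x\<bar> + \<bar>2 * p * q\<bar> * \<bar>y\<bar> + \<bar>p * (p\<^sup>2 - 3 * q\<^sup>2)\<bar> * \<bar>t\<bar>"
  proof -
    have "\<bar>a + b - c\<bar> \<le> \<bar>a\<bar> + \<bar>b\<bar> + \<bar>c\<bar>" for a b c :: real by linarith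
    from this[of "p * x" "(2 * p * q) * y" "(p * (p\<^sup>2 - 3 * q\<^sup>2)) * t"] p show ?thesis
      unfolding Re by (simp add: abs_mult)
  qed
  also have "\<dots> \<le> (wt l / \<delta>\<^sup>2) * norm d + (2 * wt l / \<delta>) * norm d + (3 * wt l) * norm d"
    using \<delta>_pos wt_nonneg[OF l] p 1 2 3 nx ny nt by (intro add_mono mult_mono) auto
  also have "\<dots> = B * norm d * wt l" by (simp add: B_def algebra_simps)
  finally show ?thesis .
qed

end

section \<open>The Hermitian form of the kernel\<close>

lemma cmod_le_cmod_add_cnj:
  assumes "0 < Re k" "0 < Re l"
  shows "Re l + Re k \<le> cmod (l + cnj k)"
  using complex_Re_le_cmod[of "l + cnj k"] by simp

definition cayley :: "complex \<Rightarrow> complex" where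
  "cayley l = (l - 1) / (l + 1)"

lemma cmod_cayley_less:
  assumes "0 < Re l"
  shows "cmod (cayley l) < 1"
proof -
  have "(cmod (l - 1))\<^sup>2 < (cmod (l + 1))\<^sup>2"
    using assms unfolding cmod_power2 by (simp add: power2_eq_square algebra_simps)
  then have "cmod (l - 1) < cmod (l + 1)"
    by (rule power_less_imp_less_base) simp
  then show ?thesis
    by (simp add: cayley_def norm_divide divide_less_eq split: if_splits)
qed

text \<open>A partial sum of the geometric series for \<open>1 / (l + cnj k)\<close>. Each summand
  is a positive multiple of \<open>cnj (b k) * b l\<close>, hence a positive rank-one kernel; the
  functions \<open>b\<close> are the monomials of the disc transported to the half plane.\<close>

definition cayley_kernel :: "nat \<Rightarrow> complex \<Rightarrow> complex \<Rightarrow> complex" where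
  "cayley_kernel n k l = (\<Sum>j<n. 1 / 2 * cnj ((1 - cayley k) * cayley k ^ j) * ((1 - cayley l) * cayley l ^ j))"

lemma cayley_kernel_eq:
  assumes "0 < Re k" "0 < Re l"
  shows "cayley_kernel n k l = (1 - (cayley l * cnj (cayley k)) ^ n) / (l + cnj k)"
proof -
  have ne: "l + cnj k \<noteq> 0" "l + 1 \<noteq> 0" "cnj k + 1 \<noteq> 0"
    using assms by (auto simp: complex_eq_iff)
  define w where "w = cayley l * cnj (cayley k)"
  have "cmod w \<noteq> 1"
    using mult_strict_mono'[OF cmod_cayley_less[OF assms(2)] cmod_cayley_less[OF assms(1)]]
    by (simp add: w_def norm_mult)
  then have w: "w \<noteq> 1" by auto
  \<comment> \<open>Both sides equal \<open>2 * (l + cnj k) / ((l + 1) * (cnj k + 1))\<close>,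
    because \<open>1 - cayley l = 2 / (l + 1)\<close>.\<close>
  have *: "1 / 2 * (1 - cayley l) * (1 - cnj (cayley k)) * (l + cnj k) = 1 - w"
    using ne by (simp add: w_def cayley_def divide_simps) (simp add: algebra_simps)
  have "cayley_kernel n k l = 1 / 2 * (1 - cayley l) * (1 - cnj (cayley k)) * (\<Sum>j<n. w ^ j)"
    by (simp add: cayley_kernel_def w_def sum_distrib_left power_mult_distrib mult_ac)
  also have "\<dots> = 1 / 2 * (1 - cayley l) * (1 - cnj (cayley k)) * ((1 - w ^ n) / (1 - w))"
    using w by (simp add: sum_gp_strict)
  also have "\<dots> = (1 - w ^ n) / (l + cnj k)"
  proof -
    have "1 / 2 * (1 - cayley l) * (1 - cnj (cayley k)) = (1 - w) / (l + cnj k)"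
      using * ne(1) by (metis nonzero_eq_divide_eq)
    then show ?thesis using w by (simp only:) simp
  qed
  finally show ?thesis by (simp add: w_def)
qed

context kp_measure begin

definition \<kappa> :: real where "\<kappa> = 1 / (2 * \<delta>)"

lemma \<kappa>_pos: "0 < \<kappa>"
  using \<delta>_pos by (simp add: \<kappa>_def)

lemma Re_pos: "l \<in> space N \<Longrightarrow> 0 < Re l"
  using Re_ge \<delta>_pos order_less_le_trans by blast

lemma cmod_inverse_le:
  assumes "k \<in> space N" "l \<in> space N"
  shows "cmod (inverse (l + cnj k)) \<le> \<kappa>"
proof -
  have "2 * \<delta> \<le> cmod (l + cnj k)"
    using cmod_le_cmod_add_cnj[OF Re_pos[OF assms(1)] Re_pos[OF assms(2)]] Re_ge[OF assms(1)] Re_ge[OF assms(2)]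
    by linarith
  then show ?thesis
    using \<delta>_pos by (simp add: \<kappa>_def norm_divide inverse_eq_divide frac_le)
qed

definition T :: "(complex \<Rightarrow> complex) \<Rightarrow> complex \<Rightarrow> complex" where
  "T a k = (\<integral>l. a l / (l + cnj k) \<partial>N)"

text \<open>The form of the bare kernel, linear in the first and conjugate linear in the second
  argument. The waves are placed in the arguments, as in \<open>ip_K\<close>, so the parameters
  enter through them alone. The kernel is bounded by \<open>\<kappa>\<close>, hence integrable
  arguments suffice.\<close>

definition Q :: "(complex \<Rightarrow> complex) \<Rightarrow> (complex \<Rightarrow> complex) \<Rightarrow> complex" where
  "Q a b = (\<integral>k. cnj (b k) * T a k \<partial>N)"

lemma T_measurable [measurable]:
  assumes [measurable]: "a \<in> borel_measurable N"
  shows "T a \<in> borel_measurable N"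
  unfolding T_def by measurable

lemma integrable_T:
  assumes "integrable N a" "k \<in> space N"
  shows "integrable N (\<lambda>l. a l / (l + cnj k))"
proof (rule Bochner_Integration.integrable_bound)
  show "integrable N (\<lambda>l. \<kappa> * cmod (a l))" using assms by simp
  show "(\<lambda>l. a l / (l + cnj k)) \<in> borel_measurable N" using assms by simp
  have "cmod (a l / (l + cnj k)) \<le> \<kappa> * cmod (a l)" if "l \<in> space N" for l
    using mult_left_mono[OF cmod_inverse_le[OF assms(2) that], of "cmod (a l)"]
    by (simp add: norm_divide norm_inverse field_simps)
  then show "AE l in N. norm (a l / (l + cnj k)) \<le> norm (\<kappa> * cmod (a l))"
    using \<kappa>_pos by (intro AE_I2) simp
qed

lemma cmod_T_le:
  assumes "integrable N a" "k \<in> space N"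
  shows "cmod (T a k) \<le> \<kappa> * (\<integral>l. cmod (a l) \<partial>N)"
proof -
  have "cmod (T a k) \<le> (\<integral>l. cmod (a l / (l + cnj k)) \<partial>N)"
    unfolding T_def by (rule integral_norm_bound)
  also have "\<dots> \<le> (\<integral>l. \<kappa> * cmod (a l) \<partial>N)"
  proof (rule integral_mono)
    show "integrable N (\<lambda>l. cmod (a l / (l + cnj k)))"
      by (intro integrable_norm integrable_T assms)
    show "cmod (a l / (l + cnj k)) \<le> \<kappa> * cmod (a l)" if "l \<in> space N" for l
      using mult_left_mono[OF cmod_inverse_le[OF assms(2) that], of "cmod (a l)"]
      by (simp add: norm_divide norm_inverse field_simps)
  qed (use assms in simp)
  finally show ?thesis by simp
qed

lemma integrable_Q:
  assumes "integrable N a" "integrable N b"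
  shows "integrable N (\<lambda>k. cnj (b k) * T a k)"
proof (rule Bochner_Integration.integrable_bound)
  show "integrable N (\<lambda>k. (\<kappa> * (\<integral>l. cmod (a l) \<partial>N)) * cmod (b k))"
    using assms by simp
  have [measurable]: "a \<in> borel_measurable N" "b \<in> borel_measurable N" using assms by auto
  show "(\<lambda>k. cnj (b k) * T a k) \<in> borel_measurable N" by measurable
  have "cmod (cnj (b k) * T a k) \<le> (\<kappa> * (\<integral>l. cmod (a l) \<partial>N)) * cmod (b k)" if "k \<in> space N" for k
    using mult_right_mono[OF cmod_T_le[OF assms(1) that], of "cmod (b k)"]
    by (simp add: norm_mult mult.commute)
  then show "AE k in N. norm (cnj (b k) * T a k) \<le> norm ((\<kappa> * (\<integral>l. cmod (a l) \<partial>N)) * cmod (b k))"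
    using \<kappa>_pos by (intro AE_I2) simp
qed

lemma cmod_Q_le:
  assumes "integrable N a" "integrable N b"
  shows "cmod (Q a b) \<le> \<kappa> * (\<integral>l. cmod (a l) \<partial>N) * (\<integral>l. cmod (b l) \<partial>N)"
proof -
  have "cmod (Q a b) \<le> (\<integral>k. cmod (cnj (b k) * T a k) \<partial>N)"
    unfolding Q_def by (rule integral_norm_bound)
  also have "\<dots> \<le> (\<integral>k. (\<kappa> * (\<integral>l. cmod (a l) \<partial>N)) * cmod (b k) \<partial>N)"
  proof (rule integral_mono)
    show "integrable N (\<lambda>k. cmod (cnj (b k) * T a k))"
      by (intro integrable_norm integrable_Q assms)
    show "cmod (cnj (b k) * T a k) \<le> (\<kappa> * (\<integral>l. cmod (a l) \<partial>N)) * cmod (b k)" if "k \<in> space N" for k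
      using mult_right_mono[OF cmod_T_le[OF assms(1) that], of "cmod (b k)"]
      by (simp add: norm_mult mult.commute)
  qed (use assms in simp)
  finally show ?thesis by simp
qed

lemma T_add:
  assumes "integrable N a" "integrable N a'" "k \<in> space N"
  shows "T (\<lambda>l. a l + a' l) k = T a k + T a' k"
  unfolding T_def add_divide_distrib
  by (rule Bochner_Integration.integral_add) (intro integrable_T assms)+

lemma Q_add_left:
  assumes "integrable N a" "integrable N a'" "integrable N b"
  shows "Q (\<lambda>l. a l + a' l) b = Q a b + Q a' b"
proof -
  have "Q (\<lambda>l. a l + a' l) b = (\<integral>k. cnj (b k) * T a k + cnj (b k) * T a' k \<partial>N)"
    unfolding Q_def using assms by (intro Bochner_Integration.integral_cong) (auto simp: T_add algebra_simps)
  also have "\<dots> = Q a b + Q a' b"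
    unfolding Q_def by (rule Bochner_Integration.integral_add) (intro integrable_Q assms)+
  finally show ?thesis .
qed

lemma Q_add_right:
  assumes "integrable N a" "integrable N b" "integrable N b'"
  shows "Q a (\<lambda>l. b l + b' l) = Q a b + Q a b'"
proof -
  have "Q a (\<lambda>l. b l + b' l) = (\<integral>k. cnj (b k) * T a k + cnj (b' k) * T a k \<partial>N)"
    unfolding Q_def by (intro Bochner_Integration.integral_cong) (auto simp: algebra_simps)
  also have "\<dots> = Q a b + Q a b'"
    unfolding Q_def by (rule Bochner_Integration.integral_add) (intro integrable_Q assms)+
  finally show ?thesis .
qed

section \<open>Rank-one expansion of the form \<open>Q\<close>\<close>

definition moment :: "(complex \<Rightarrow> complex) \<Rightarrow> nat \<Rightarrow> complex" where
  "moment a j = (\<integral>l. a l * ((1 - cayley l) * cayley l ^ j) \<partial>N)"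

lemma cayley_measurable [measurable]: "cayley \<in> borel_measurable N"
  unfolding cayley_def[abs_def] by measurable

lemma integrable_moment:
  assumes "integrable N a"
  shows "integrable N (\<lambda>l. a l * ((1 - cayley l) * cayley l ^ j))"
proof (rule Bochner_Integration.integrable_bound)
  show "integrable N (\<lambda>l. 2 * cmod (a l))" using assms by simp
  have [measurable]: "a \<in> borel_measurable N" using assms by auto
  show "(\<lambda>l. a l * ((1 - cayley l) * cayley l ^ j)) \<in> borel_measurable N" by measurable
  have "cmod ((1 - cayley l) * cayley l ^ j) \<le> 2 * 1" if "l \<in> space N" for l
    unfolding norm_mult norm_power
  proof (intro mult_mono)
    show "cmod (1 - cayley l) \<le> 2"
      using norm_triangle_ineq4[of 1 "cayley l"] cmod_cayley_less[OF Re_pos[OF that]] by simp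
    show "cmod (cayley l) ^ j \<le> 1"
      using cmod_cayley_less[OF Re_pos[OF that]] by (intro power_le_one) auto
  qed auto
  from mult_left_mono[OF this, of _ "cmod (a _)"]
  show "AE l in N. norm (a l * ((1 - cayley l) * cayley l ^ j)) \<le> norm (2 * cmod (a l))"
    by (intro AE_I2) (simp add: norm_mult mult_ac)
qed

text \<open>Uniform in \<open>n\<close>, as dominated convergence requires: Cayley images lie in the
  unit disc, so the numerator \<open>1 - w ^ n\<close> has modulus at most 2.\<close>

lemma cmod_cayley_kernel_le:
  assumes "k \<in> space N" "l \<in> space N"
  shows "cmod (cayley_kernel n k l) \<le> 2 * \<kappa>"
proof -
  define w where "w = cayley l * cnj (cayley k)"
  have "cmod w \<le> 1"
    using mult_mono[OF less_imp_le[OF cmod_cayley_less[OF Re_pos[OF assms(2)]]] less_imp_le[OF cmod_cayley_less[OF Re_pos[OF assms(1)]]]]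
    by (simp add: w_def norm_mult)
  then have "cmod (1 - w ^ n) \<le> 2"
    using norm_triangle_ineq4[of 1 "w ^ n"] power_le_one[of "cmod w" n] by (simp add: norm_power)
  then have "cmod (1 - w ^ n) * cmod (inverse (l + cnj k)) \<le> 2 * \<kappa>"
    using cmod_inverse_le[OF assms] by (intro mult_mono) auto
  then show ?thesis
    using cayley_kernel_eq[OF Re_pos[OF assms(1)] Re_pos[OF assms(2)], of n]
    by (simp add: w_def divide_inverse norm_mult)
qed

lemma cayley_kernel_tendsto:
  assumes "k \<in> space N" "l \<in> space N"
  shows "(\<lambda>n. cayley_kernel n k l) \<longlonglongrightarrow> 1 / (l + cnj k)"
proof -
  define w where "w = cayley l * cnj (cayley k)"
  have "cmod w < 1"
    using mult_strict_mono'[OF cmod_cayley_less[OF Re_pos[OF assms(2)]] cmod_cayley_less[OF Re_pos[OF assms(1)]]]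
    by (simp add: w_def norm_mult)
  then have "(\<lambda>n. w ^ n) \<longlonglongrightarrow> 0" by (intro LIMSEQ_power_zero)
  then have "(\<lambda>n. (1 - w ^ n) / (l + cnj k)) \<longlonglongrightarrow> (1 - 0) / (l + cnj k)"
    unfolding divide_inverse
    by (intro tendsto_mult[OF tendsto_diff[OF tendsto_const] tendsto_const])
  then show ?thesis
    using cayley_kernel_eq[OF Re_pos[OF assms(1)] Re_pos[OF assms(2)]] by (simp add: w_def)
qed

lemma cayley_kernel_measurable [measurable]:
  "(\<lambda>l. cayley_kernel n k l) \<in> borel_measurable N"
  unfolding cayley_kernel_def by measurable

lemma integral_cayley_kernel:
  assumes "integrable N a"
  shows "(\<integral>l. a l * cayley_kernel n k l \<partial>N)
    = (\<Sum>j<n. 1 / 2 * cnj ((1 - cayley k) * cayley k ^ j) * moment a j)"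
proof -
  have "(\<integral>l. a l * cayley_kernel n k l \<partial>N)
    = (\<integral>l. (\<Sum>j<n. (1 / 2 * cnj ((1 - cayley k) * cayley k ^ j)) * (a l * ((1 - cayley l) * cayley l ^ j))) \<partial>N)"
    by (simp add: cayley_kernel_def sum_distrib_left mult_ac)
  also have "\<dots> = (\<Sum>j<n. \<integral>l. (1 / 2 * cnj ((1 - cayley k) * cayley k ^ j)) * (a l * ((1 - cayley l) * cayley l ^ j)) \<partial>N)"
    by (intro Bochner_Integration.integral_sum integrable_mult_right integrable_moment assms)
  finally show ?thesis
    by (simp add: moment_def)
qed

text \<open>The expansion of the kernel into rank-one terms shows at once that \<open>Q\<close> is Hermitian and
  positive.\<close>

lemma Q_moment_tendsto:
  assumes "integrable N a" "integrable N b"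
  shows "(\<lambda>n. \<Sum>j<n. 1 / 2 * (moment a j * cnj (moment b j))) \<longlonglongrightarrow> Q a b"
proof -
  have [measurable]: "a \<in> borel_measurable N" "b \<in> borel_measurable N" using assms by auto
  have inner: "(\<lambda>n. \<integral>l. a l * cayley_kernel n k l \<partial>N) \<longlonglongrightarrow> T a k" if k: "k \<in> space N" for k
    unfolding T_def
  proof (rule integral_dominated_convergence)
    show "integrable N (\<lambda>l. 2 * \<kappa> * cmod (a l))" using assms by simp
    show "AE l in N. (\<lambda>n. a l * cayley_kernel n k l) \<longlonglongrightarrow> a l / (l + cnj k)"
      using tendsto_mult[OF tendsto_const cayley_kernel_tendsto[OF k]]
      by (intro AE_I2) fastforce
    show "AE l in N. norm (a l * cayley_kernel n k l) \<le> 2 * \<kappa> * cmod (a l)" for n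
      using mult_left_mono[OF cmod_cayley_kernel_le[OF k], of _ "cmod (a _)"]
      by (intro AE_I2) (simp add: norm_mult mult_ac)
  qed measurable
  have bound: "cmod (\<integral>l. a l * cayley_kernel n k l \<partial>N) \<le> 2 * \<kappa> * (\<integral>l. cmod (a l) \<partial>N)"
    if k: "k \<in> space N" for n k
  proof -
    have le: "cmod (a l * cayley_kernel n k l) \<le> 2 * \<kappa> * cmod (a l)" if "l \<in> space N" for l
      using mult_left_mono[OF cmod_cayley_kernel_le[OF k that], of "cmod (a l)"]
      by (simp add: norm_mult mult_ac)
    have "cmod (\<integral>l. a l * cayley_kernel n k l \<partial>N) \<le> (\<integral>l. cmod (a l * cayley_kernel n k l) \<partial>N)"
      by (rule integral_norm_bound)
    also have "\<dots> \<le> (\<integral>l. 2 * \<kappa> * cmod (a l) \<partial>N)"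
    proof (rule integral_mono)
      show "integrable N (\<lambda>l. cmod (a l * cayley_kernel n k l))"
        by (rule Bochner_Integration.integrable_bound[of _ "\<lambda>l. 2 * \<kappa> * cmod (a l)"])
          (use assms le \<kappa>_pos in \<open>auto intro!: AE_I2\<close>)
    qed (use assms le in auto)
    finally show ?thesis by simp
  qed
  \<comment> \<open>A second passage to the limit, now in the outer integral; \<open>bound\<close>
    makes the inner integrals uniformly bounded in \<open>n\<close> and \<open>k\<close>, so a
    multiple of \<open>|b|\<close> dominates.\<close>
  have "(\<lambda>n. \<integral>k. cnj (b k) * (\<integral>l. a l * cayley_kernel n k l \<partial>N) \<partial>N) \<longlonglongrightarrow> Q a b"
    unfolding Q_def
  proof (rule integral_dominated_convergence)
    show "integrable N (\<lambda>k. (2 * \<kappa> * (\<integral>l. cmod (a l) \<partial>N)) * cmod (b k))"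
      using assms by simp
    show "AE k in N. (\<lambda>n. cnj (b k) * (\<integral>l. a l * cayley_kernel n k l \<partial>N)) \<longlonglongrightarrow> cnj (b k) * T a k"
      by (intro AE_I2 tendsto_intros inner)
    show "AE k in N. norm (cnj (b k) * (\<integral>l. a l * cayley_kernel n k l \<partial>N))
        \<le> (2 * \<kappa> * (\<integral>l. cmod (a l) \<partial>N)) * cmod (b k)" for n
      using mult_right_mono[OF bound, of _ "cmod (b _)"]
      by (intro AE_I2) (simp add: norm_mult mult_ac)
  qed (simp_all add: integral_cayley_kernel assms)
  moreover have "(\<integral>k. cnj (b k) * (\<integral>l. a l * cayley_kernel n k l \<partial>N) \<partial>N)
      = (\<Sum>j<n. 1 / 2 * (moment a j * cnj (moment b j)))" for n
  proof -
    have "(\<integral>k. cnj (b k) * (\<integral>l. a l * cayley_kernel n k l \<partial>N) \<partial>N)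
      = (\<integral>k. (\<Sum>j<n. (1 / 2 * moment a j) * cnj (b k * ((1 - cayley k) * cayley k ^ j))) \<partial>N)"
      by (simp add: integral_cayley_kernel assms(1) sum_distrib_left mult_ac)
    also have "\<dots> = (\<Sum>j<n. \<integral>k. (1 / 2 * moment a j) * cnj (b k * ((1 - cayley k) * cayley k ^ j)) \<partial>N)"
      by (intro Bochner_Integration.integral_sum integrable_mult_right integrable_cnj integrable_moment assms)
    also have "\<dots> = (\<Sum>j<n. 1 / 2 * (moment a j * cnj (moment b j)))"
      by (simp only: integral_mult_right_zero Bochner_Integration.integral_cnj moment_def mult.assoc)
    finally show ?thesis .
  qed
  ultimately show ?thesis by simp
qed

lemma Q_hermitian:
  assumes "integrable N a" "integrable N b"
  shows "Q b a = cnj (Q a b)"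
proof (rule LIMSEQ_unique)
  show "(\<lambda>n. \<Sum>j<n. 1 / 2 * (moment b j * cnj (moment a j))) \<longlonglongrightarrow> Q b a"
    by (rule Q_moment_tendsto[OF assms(2,1)])
  show "(\<lambda>n. \<Sum>j<n. 1 / 2 * (moment b j * cnj (moment a j))) \<longlonglongrightarrow> cnj (Q a b)"
    using tendsto_cnj[OF Q_moment_tendsto[OF assms]] by (simp add: mult_ac)
qed

lemma Q_nonneg:
  assumes "integrable N a"
  shows "0 \<le> Re (Q a a)"
proof (rule LIMSEQ_le_const)
  show "(\<lambda>n. Re (\<Sum>j<n. 1 / 2 * (moment a j * cnj (moment a j)))) \<longlonglongrightarrow> Re (Q a a)"
    by (rule tendsto_Re[OF Q_moment_tendsto[OF assms assms]])
  show "\<exists>N. \<forall>n\<ge>N. 0 \<le> Re (\<Sum>j<n. 1 / 2 * (moment a j * cnj (moment a j)))"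
    by (auto simp: complex_mult_cnj intro!: sum_nonneg)
qed

end

section \<open>Solving the integral equation\<close>

context kp_measure begin

definition ip :: "(complex \<Rightarrow> complex) \<Rightarrow> (complex \<Rightarrow> complex) \<Rightarrow> complex" where
  "ip f h = (\<integral>l. cnj (f l) * h l \<partial>N)"

definition K :: "(complex \<Rightarrow> complex) \<Rightarrow> (complex \<Rightarrow> complex) \<Rightarrow> complex \<Rightarrow> complex" where
  "K e \<phi> k = cnj (e k) * T (\<lambda>l. e l * \<phi> l) k"

lemma integrable_ip:
  "square_integrable N f \<Longrightarrow> square_integrable N h \<Longrightarrow> integrable N (\<lambda>l. cnj (f l) * h l)"
  by (intro square_integrable_mult square_integrable_cnj)

lemma ip_add_right:
  assumes "square_integrable N f" "square_integrable N h" "square_integrable N h'"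
  shows "ip f (\<lambda>l. h l + h' l) = ip f h + ip f h'"
  unfolding ip_def distrib_left
  by (intro Bochner_Integration.integral_add integrable_ip assms)

lemma ip_diff_right:
  assumes "square_integrable N f" "square_integrable N h" "square_integrable N h'"
  shows "ip f (\<lambda>l. h l - h' l) = ip f h - ip f h'"
  unfolding ip_def right_diff_distrib
  by (intro Bochner_Integration.integral_diff integrable_ip assms)

lemma ip_cnj: "ip h f = cnj (ip f h)"
  unfolding ip_def Bochner_Integration.integral_cnj[symmetric] by (simp add: mult.commute)

lemma ip_diff_left:
  assumes "square_integrable N f" "square_integrable N h" "square_integrable N h'"
  shows "ip (\<lambda>l. h l - h' l) f = ip h f - ip h' f"
  using ip_diff_right[OF assms] by (metis ip_cnj complex_cnj_diff)

lemma ip_self: "ip f f = of_real ((L2norm N f)\<^sup>2)"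
proof -
  have "ip f f = (\<integral>l. of_real ((cmod (f l))\<^sup>2) \<partial>N)"
    unfolding ip_def by (simp only: complex_norm_square mult.commute)
  then show ?thesis
    by (simp add: L2norm_power2 del: of_real_power)
qed

lemma cmod_ip_le:
  "square_integrable N f \<Longrightarrow> square_integrable N h \<Longrightarrow> cmod (ip f h) \<le> L2norm N f * L2norm N h"
  using Cauchy_Schwarz_L2[OF square_integrable_cnj, of N f h] by (simp add: ip_def)

lemma K_measurable [measurable]:
  assumes [measurable]: "e \<in> borel_measurable N" "\<phi> \<in> borel_measurable N"
  shows "K e \<phi> \<in> borel_measurable N"
  unfolding K_def[abs_def] by measurable

text \<open>A bounded kernel and the Cauchy-Schwarz inequality turn \<open>L\<^sup>2\<close> control
  of \<open>\<phi>\<close> into pointwise control by \<open>|e|\<close>. The pointwise convergence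
  of the iteration rests on this.\<close>

lemma cmod_K_le:
  assumes e: "square_integrable N e" and \<phi>: "square_integrable N \<phi>" and k: "k \<in> space N"
  shows "cmod (K e \<phi> k) \<le> \<kappa> * L2norm N e * L2norm N \<phi> * cmod (e k)"
proof -
  have "cmod (T (\<lambda>l. e l * \<phi> l) k) \<le> \<kappa> * (\<integral>l. cmod (e l * \<phi> l) \<partial>N)"
    by (rule cmod_T_le[OF square_integrable_mult[OF e \<phi>] k])
  also have "\<dots> \<le> \<kappa> * (L2norm N e * L2norm N \<phi>)"
    using Cauchy_Schwarz_L2_norm[OF e \<phi>] \<kappa>_pos by (simp add: norm_mult)
  finally have "cmod (T (\<lambda>l. e l * \<phi> l) k) * cmod (e k) \<le> \<kappa> * (L2norm N e * L2norm N \<phi>) * cmod (e k)"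
    by (intro mult_right_mono) auto
  then show ?thesis by (simp add: K_def norm_mult mult_ac)
qed

lemma K_square_integrable:
  assumes "square_integrable N e" "square_integrable N \<phi>"
  shows "square_integrable N (K e \<phi>)"
proof (rule square_integrable_bound[OF assms(1)])
  show "K e \<phi> \<in> borel_measurable N" using assms by measurable
qed (rule cmod_K_le[OF assms])

lemma L2norm_K_le:
  assumes "square_integrable N e" "square_integrable N \<phi>"
  shows "L2norm N (K e \<phi>) \<le> \<kappa> * (L2norm N e)\<^sup>2 * L2norm N \<phi>"
proof -
  have "K e \<phi> \<in> borel_measurable N" using assms by measurable
  from L2norm_bound[OF assms(1) this _ cmod_K_le[OF assms]] show ?thesis
    using \<kappa>_pos by (simp add: power2_eq_square mult_ac)
qed

lemma ip_K: "ip f (K e h) = Q (\<lambda>l. e l * h l) (\<lambda>l. e l * f l)"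
  by (simp add: ip_def K_def Q_def mult_ac)

section \<open>The coercive operator \<open>1 + K\<close>\<close>

definition A :: "(complex \<Rightarrow> complex) \<Rightarrow> (complex \<Rightarrow> complex) \<Rightarrow> complex \<Rightarrow> complex" where
  "A e \<phi> k = \<phi> k + K e \<phi> k"

lemma A_square_integrable:
  "square_integrable N e \<Longrightarrow> square_integrable N \<phi> \<Longrightarrow> square_integrable N (A e \<phi>)"
  unfolding A_def[abs_def] by (intro square_integrable_add K_square_integrable)

lemma ip_A:
  assumes "square_integrable N e" "square_integrable N f" "square_integrable N h"
  shows "ip f (A e h) = ip f h + Q (\<lambda>l. e l * h l) (\<lambda>l. e l * f l)"
  unfolding A_def[abs_def] ip_K[symmetric]
  by (intro ip_add_right K_square_integrable assms)

lemma A_symmetric: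
  assumes "square_integrable N e" "square_integrable N f" "square_integrable N h"
  shows "ip f (A e h) = ip (A e f) h"
proof -
  have "ip f (A e h) = ip f h + Q (\<lambda>l. e l * h l) (\<lambda>l. e l * f l)"
    by (rule ip_A[OF assms])
  also have "\<dots> = cnj (ip h f + Q (\<lambda>l. e l * f l) (\<lambda>l. e l * h l))"
    using ip_cnj[of h f] Q_hermitian[OF square_integrable_mult square_integrable_mult, OF assms(1,3,1,2)]
    by simp
  also have "\<dots> = ip (A e f) h"
    by (simp only: ip_A[OF assms(1,3,2)] ip_cnj[of "A e f" h])
  finally show ?thesis .
qed

lemma A_coercive:
  assumes "square_integrable N e" "square_integrable N \<phi>"
  shows "(L2norm N \<phi>)\<^sup>2 \<le> Re (ip \<phi> (A e \<phi>))"
  using Q_nonneg[OF square_integrable_mult[OF assms]] by (simp add: ip_A assms ip_self)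

text \<open>Coercivity combined with Cauchy-Schwarz. The constant 1 does not depend on
  \<open>e\<close>, so solutions are bounded by their right-hand sides for all parameters at once;
  the decay in \<open>x\<close> relies on this.\<close>

lemma L2norm_le_A:
  assumes "square_integrable N e" "square_integrable N \<phi>"
  shows "L2norm N \<phi> \<le> L2norm N (A e \<phi>)"
proof (cases "L2norm N \<phi> = 0")
  case False
  have "L2norm N \<phi> * L2norm N \<phi> \<le> cmod (ip \<phi> (A e \<phi>))"
    using A_coercive[OF assms] complex_Re_le_cmod[of "ip \<phi> (A e \<phi>)"] by (simp add: power2_eq_square)
  also have "\<dots> \<le> L2norm N \<phi> * L2norm N (A e \<phi>)"
    by (intro cmod_ip_le A_square_integrable assms)
  finally show ?thesis using False by (simp add: mult_le_cancel_left less_le)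
qed simp

text \<open>One Richardson step for the equation \<open>A e \<phi> = f\<close> contracts the error in \<open>L\<^sup>2\<close>.\<close>

lemma richardson_contraction:
  assumes e: "square_integrable N e"
  obtains \<epsilon> :: real where "0 < \<epsilon>" "\<epsilon> < 1"
    "\<And>\<phi>. square_integrable N \<phi> \<Longrightarrow>
       L2norm N (\<lambda>k. \<phi> k - of_real \<epsilon> * A e \<phi> k) \<le> sqrt (1 - \<epsilon>) * L2norm N \<phi>"
proof -
  define b where "b = \<kappa> * (L2norm N e)\<^sup>2"
  \<comment> \<open>\<open>2 + 2 * b\<^sup>2\<close> bounds the squared operator norm of
    \<open>A e\<close>, and this step size minimises \<open>1 - 2 * \<epsilon> + \<epsilon>\<^sup>2
    * (2 + 2 * b\<^sup>2)\<close>; the minimum is \<open>1 - \<epsilon>\<close>.\<close>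
  define \<epsilon> where "\<epsilon> = 1 / (2 + 2 * b\<^sup>2)"
  have \<epsilon>: "0 < \<epsilon>" "\<epsilon> < 1" by (auto simp: \<epsilon>_def intro!: divide_pos_pos add_pos_nonneg) (simp add: divide_less_eq add_pos_nonneg)
  have *: "\<epsilon>\<^sup>2 * (2 + 2 * b\<^sup>2) = \<epsilon>"
    using \<epsilon>(1) by (simp add: \<epsilon>_def power2_eq_square)
  show ?thesis
  proof (rule that[OF \<epsilon>])
    fix \<phi> assume \<phi>: "square_integrable N \<phi>"
    note K = K_square_integrable[OF e \<phi>] and A = A_square_integrable[OF e \<phi>]
    have [simp]: "integrable N (\<lambda>l. (cmod (\<phi> l))\<^sup>2)" "integrable N (\<lambda>l. (cmod (K e \<phi> l))\<^sup>2)"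
      "integrable N (\<lambda>l. (cmod (A e \<phi> l))\<^sup>2)" "integrable N (\<lambda>l. cnj (\<phi> l) * A e \<phi> l)"
      using \<phi> K A integrable_ip[OF \<phi> A] by (auto simp: square_integrable_def)
    have "(L2norm N (A e \<phi>))\<^sup>2 \<le> (\<integral>l. 2 * (cmod (\<phi> l))\<^sup>2 + 2 * (cmod (K e \<phi> l))\<^sup>2 \<partial>N)"
      unfolding L2norm_power2
    proof (rule integral_mono)
      fix l
      have "(cmod (A e \<phi> l))\<^sup>2 \<le> (cmod (\<phi> l) + cmod (K e \<phi> l))\<^sup>2"
        unfolding A_def by (intro power_mono norm_triangle_ineq) auto
      then show "(cmod (A e \<phi> l))\<^sup>2 \<le> 2 * (cmod (\<phi> l))\<^sup>2 + 2 * (cmod (K e \<phi> l))\<^sup>2"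
        using sum_squares_bound[of "cmod (\<phi> l)" "cmod (K e \<phi> l)"] by (simp add: power2_sum)
    qed auto
    also have "\<dots> = 2 * (L2norm N \<phi>)\<^sup>2 + 2 * (L2norm N (K e \<phi>))\<^sup>2"
      by (simp add: L2norm_power2)
    also have "\<dots> \<le> 2 * (L2norm N \<phi>)\<^sup>2 + 2 * (b * L2norm N \<phi>)\<^sup>2"
      using power_mono[OF L2norm_K_le[OF e \<phi>] L2norm_nonneg, of 2] by (simp add: b_def)
    finally have nA: "(L2norm N (A e \<phi>))\<^sup>2 \<le> (2 + 2 * b\<^sup>2) * (L2norm N \<phi>)\<^sup>2"
      by (simp add: algebra_simps power_mult_distrib)
    have "(L2norm N (\<lambda>k. \<phi> k - of_real \<epsilon> * A e \<phi> k))\<^sup>2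
      = (\<integral>l. (cmod (\<phi> l))\<^sup>2 - 2 * \<epsilon> * Re (cnj (\<phi> l) * A e \<phi> l) + \<epsilon>\<^sup>2 * (cmod (A e \<phi> l))\<^sup>2 \<partial>N)"
      unfolding L2norm_power2 cmod_power2
      by (rule Bochner_Integration.integral_cong) (auto simp: power2_eq_square algebra_simps)
    also have "\<dots> = (L2norm N \<phi>)\<^sup>2 - 2 * \<epsilon> * Re (ip \<phi> (A e \<phi>)) + \<epsilon>\<^sup>2 * (L2norm N (A e \<phi>))\<^sup>2"
      by (simp add: L2norm_power2 ip_def del: times_complex.sel)
    also have "\<dots> \<le> (L2norm N \<phi>)\<^sup>2 - 2 * \<epsilon> * (L2norm N \<phi>)\<^sup>2 + \<epsilon>\<^sup>2 * ((2 + 2 * b\<^sup>2) * (L2norm N \<phi>)\<^sup>2)"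
      using \<epsilon>(1) by (intro add_mono diff_mono mult_left_mono A_coercive[OF e \<phi>] nA) auto
    also have "\<dots> = (1 - \<epsilon>) * (L2norm N \<phi>)\<^sup>2"
      unfolding mult.assoc[symmetric] * by (simp add: algebra_simps)
    finally have "L2norm N (\<lambda>k. \<phi> k - of_real \<epsilon> * A e \<phi> k) \<le> sqrt ((1 - \<epsilon>) * (L2norm N \<phi>)\<^sup>2)"
      by (rule real_le_rsqrt)
    then show "L2norm N (\<lambda>k. \<phi> k - of_real \<epsilon> * A e \<phi> k) \<le> sqrt (1 - \<epsilon>) * L2norm N \<phi>"
      by (simp add: real_sqrt_mult)
  qed
qed

text \<open>The increments of the Richardson iteration decay geometrically in \<open>L\<^sup>2\<close>; as \<open>K e\<close> turns
  \<open>L\<^sup>2\<close> bounds into pointwise ones, they also decay geometrically pointwise, and their sum solves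
  the equation.\<close>

lemma A_solvable:
  assumes me: "moderate e" and mf: "moderate f"
  shows "\<exists>\<phi>. moderate \<phi> \<and> (\<forall>k\<in>space N. A e \<phi> k = f k)"
proof -
  have e: "square_integrable N e" and f: "square_integrable N f"
    using me mf by (auto intro: moderate_square_integrable)
  note [measurable] = moderate_measurable[OF me] moderate_measurable[OF mf]
  obtain \<epsilon> :: real where \<epsilon>: "0 < \<epsilon>" "\<epsilon> < 1" and contr: "\<And>\<phi>. square_integrable N \<phi> \<Longrightarrow>
       L2norm N (\<lambda>k. \<phi> k - of_real \<epsilon> * A e \<phi> k) \<le> sqrt (1 - \<epsilon>) * L2norm N \<phi>"
    by (rule richardson_contraction[OF e]) blast
  \<comment> \<open>The increments of the iteration that starts at 0 and adds
    \<open>\<epsilon>\<close> times the residual \<open>f - A e \<phi>\<close>.\<close>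
  define D where "D = rec_nat (\<lambda>k. of_real \<epsilon> * f k) (\<lambda>_ \<phi> k. \<phi> k - of_real \<epsilon> * A e \<phi> k)"
  have D0: "D 0 = (\<lambda>k. of_real \<epsilon> * f k)"
    and DS: "D (Suc n) = (\<lambda>k. D n k - of_real \<epsilon> * A e (D n) k)" for n
    by (simp_all add: D_def)
  have D: "square_integrable N (D n)" for n
    by (induction n)
      (auto simp: D0 DS intro!: square_integrable_cmult f square_integrable_diff A_square_integrable e)
  note [measurable] = square_integrable_measurable[OF D]
  define \<rho> where "\<rho> = sqrt (1 - \<epsilon>)"
  have \<rho>: "0 \<le> \<rho>" "\<rho> < 1" "1 - \<epsilon> \<le> \<rho>"
  proof -
    show "0 \<le> \<rho>" "\<rho> < 1" using \<epsilon> by (auto simp: \<rho>_def)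
    have "(1 - \<epsilon>)\<^sup>2 \<le> 1 - \<epsilon>" using \<epsilon> by (simp add: power2_eq_square mult_left_le_one_le)
    then show "1 - \<epsilon> \<le> \<rho>" unfolding \<rho>_def by (rule real_le_rsqrt)
  qed
  have normD: "L2norm N (D n) \<le> \<rho> ^ n * L2norm N (D 0)" for n
  proof (induction n)
    case (Suc n)
    have "L2norm N (D (Suc n)) \<le> \<rho> * L2norm N (D n)"
      unfolding DS \<rho>_def by (rule contr[OF D])
    also have "\<dots> \<le> \<rho> * (\<rho> ^ n * L2norm N (D 0))"
      using Suc \<rho>(1) by (rule mult_left_mono)
    finally show ?case by simp
  qed simp
  \<comment> \<open>The pointwise recursion combines the factor \<open>1 - \<epsilon>\<close> with a
    source decaying like \<open>\<rho> ^ n\<close>. A single rate strictly above both and below 1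
    leaves room for a geometric bound.\<close>
  define r where "r = (1 + \<rho>) / 2"
  have r: "0 < r" "r < 1" "\<rho> \<le> r" "1 - \<epsilon> < r"
    using \<rho> by (auto simp: r_def)
  define G where "G k = cmod (f k) + cmod (e k)" for k
  define C1 where "C1 = \<kappa> * L2norm N e * L2norm N (D 0)"
  \<comment> \<open>The first summand starts the induction; the second makes
    \<open>(1 - \<epsilon>) * C + \<epsilon> * C1 \<le> C * r\<close>, which is the induction
    step.\<close>
  define C where "C = \<epsilon> + \<epsilon> * C1 / (r - (1 - \<epsilon>))"
  have C1: "0 \<le> C1" using \<kappa>_pos by (simp add: C1_def)
  have C: "\<epsilon> \<le> C" "\<epsilon> * C1 \<le> C * (r - (1 - \<epsilon>))" "0 < C"
  proof -
    show "\<epsilon> \<le> C" using C1 \<epsilon> r by (simp add: C_def)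
    then show "0 < C" using \<epsilon> by simp
    have "C * (r - (1 - \<epsilon>)) = \<epsilon> * (r - (1 - \<epsilon>)) + \<epsilon> * C1"
      using r(4) by (simp add: C_def distrib_right)
    then show "\<epsilon> * C1 \<le> C * (r - (1 - \<epsilon>))" using \<epsilon> r(4) by simp
  qed
  have ptD: "cmod (D n k) \<le> C * r ^ n * G k" if k: "k \<in> space N" for n k
  proof (induction n)
    case 0
    have "\<epsilon> * cmod (f k) \<le> C * G k"
      using C \<epsilon> by (intro mult_mono) (auto simp: G_def)
    then show ?case using \<epsilon> by (simp add: D0 norm_mult)
  next
    case (Suc n)
    have "cmod (K e (D n) k) \<le> \<kappa> * L2norm N e * L2norm N (D n) * cmod (e k)"
      by (rule cmod_K_le[OF e D k])
    also have "\<dots> \<le> \<kappa> * L2norm N e * (r ^ n * L2norm N (D 0)) * G k"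
    proof (intro mult_mono mult_left_mono)
      have "\<rho> ^ n * L2norm N (D 0) \<le> r ^ n * L2norm N (D 0)"
        using \<rho> r by (intro mult_right_mono power_mono) auto
      with normD[of n] show "L2norm N (D n) \<le> r ^ n * L2norm N (D 0)" by linarith
    qed (use \<kappa>_pos r in \<open>auto simp: G_def\<close>)
    finally have K: "cmod (K e (D n) k) \<le> C1 * r ^ n * G k"
      by (simp add: C1_def mult_ac)
    have "D (Suc n) k = of_real (1 - \<epsilon>) * D n k - of_real \<epsilon> * K e (D n) k"
      by (simp add: DS A_def algebra_simps)
    then have "cmod (D (Suc n) k) \<le> (1 - \<epsilon>) * cmod (D n k) + \<epsilon> * cmod (K e (D n) k)"
      using norm_triangle_ineq4[of "of_real (1 - \<epsilon>) * D n k" "of_real \<epsilon> * K e (D n) k"] \<epsilon>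
      by (simp add: norm_mult del: of_real_diff)
    also have "\<dots> \<le> (1 - \<epsilon>) * (C * r ^ n * G k) + \<epsilon> * (C1 * r ^ n * G k)"
      using \<epsilon> Suc K by (intro add_mono mult_left_mono) auto
    also have "\<dots> = ((1 - \<epsilon>) * C + \<epsilon> * C1) * (r ^ n * G k)" by (simp add: algebra_simps)
    also have "\<dots> \<le> (C * r) * (r ^ n * G k)"
      using C(2) r by (intro mult_right_mono) (auto simp: G_def algebra_simps)
    finally show ?case by (simp add: algebra_simps)
  qed
  have sum_r: "summable (\<lambda>n. C * r ^ n * c)" for c
    using r by (intro summable_mult2 summable_mult summable_geometric) auto
  have sumD: "summable (\<lambda>n. cmod (D n k))" if "k \<in> space N" for k
    by (rule summable_comparison_test'[OF sum_r, of 0]) (use ptD[OF that] in auto)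
  define \<phi> where "\<phi> k = (\<Sum>n. D n k)" for k
  have D_sums: "(\<lambda>n. D n k) sums \<phi> k" if "k \<in> space N" for k
    unfolding \<phi>_def using summable_norm_cancel[OF sumD[OF that]] by (rule summable_sums)
  have \<phi>_measurable [measurable]: "\<phi> \<in> borel_measurable N"
    unfolding \<phi>_def[abs_def] by measurable
  have \<phi>_le: "cmod (\<phi> k) \<le> C / (1 - r) * G k" if k: "k \<in> space N" for k
  proof -
    have "cmod (\<phi> k) \<le> (\<Sum>n. cmod (D n k))"
      unfolding \<phi>_def by (rule summable_norm[OF sumD[OF k]])
    also have "\<dots> \<le> (\<Sum>n. C * r ^ n * G k)"
      by (rule suminf_le[OF ptD[OF k] sumD[OF k] sum_r])
    also have "\<dots> = C / (1 - r) * G k"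
      using r by (simp add: suminf_mult suminf_mult2[symmetric] summable_mult summable_geometric suminf_geometric)
    finally show ?thesis .
  qed
  have mG: "moderate (\<lambda>k. of_real (G k))"
  proof -
    obtain C2 c2 where f2: "0 \<le> C2" "0 \<le> c2" "\<forall>l\<in>space N. cmod (f l) \<le> C2 * exp (c2 * wt l)"
      by (rule moderateE[OF mf])
    obtain C3 c3 where e3: "0 \<le> C3" "0 \<le> c3" "\<forall>l\<in>space N. cmod (e l) \<le> C3 * exp (c3 * wt l)"
      by (rule moderateE[OF me])
    have "moderate (\<lambda>l. of_real (cmod (f l)))" "moderate (\<lambda>l. of_real (cmod (e l)))"
      by (rule moderateI[of _ C2 c2]; use f2 in auto) (rule moderateI[of _ C3 c3]; use e3 in auto)
    from moderate_add[OF this] show ?thesis by (simp add: G_def)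
  qed
  have m\<phi>: "moderate \<phi>"
  proof -
    have "moderate (\<lambda>k. of_real (C / (1 - r)) * of_real (G k))" (is "moderate ?g")
      by (intro moderate_mult moderate_const mG)
    then obtain C' c' where g: "0 \<le> C'" "0 \<le> c'" "\<forall>l\<in>space N. cmod (?g l) \<le> C' * exp (c' * wt l)"
      by (rule moderateE)
    show ?thesis
    proof (rule moderateI[OF \<phi>_measurable])
      fix k assume k: "k \<in> space N"
      have "cmod (\<phi> k) \<le> cmod (?g k)"
        using \<phi>_le[OF k] unfolding of_real_mult[symmetric] norm_of_real by linarith
      with g(3) k show "cmod (\<phi> k) \<le> C' * exp (c' * wt k)" by force
    qed
  qed
  have K_sums: "(\<lambda>n. K e (D n) k) sums K e \<phi> k" if k: "k \<in> space N" for k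
  proof -
    have int: "integrable N (\<lambda>l. e l * D i l / (l + cnj k))" for i
      by (intro integrable_T square_integrable_mult e D k)
    have mG': "integrable N (\<lambda>l. cmod (e l) * G l)"
    proof -
      have "integrable N (\<lambda>l. e l * of_real (G l))"
        by (intro moderate_integrable moderate_mult me mG)
      from integrable_norm[OF this] show ?thesis by (simp add: norm_mult G_def del: of_real_add)
    qed
    have le: "cmod (e l * D i l / (l + cnj k)) \<le> C * r ^ i * (\<kappa> * (cmod (e l) * G l))" if l: "l \<in> space N" for i l
    proof -
      have "cmod (e l) * cmod (D i l) * cmod (inverse (l + cnj k)) \<le> cmod (e l) * (C * r ^ i * G l) * \<kappa>"
        using cmod_inverse_le[OF k l] ptD[OF l, of i] C r \<kappa>_pos
        by (intro mult_mono mult_left_mono) (auto simp: G_def)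
      then show ?thesis by (simp add: norm_mult divide_inverse mult_ac)
    qed
    have "(\<lambda>i. \<integral>l. e l * D i l / (l + cnj k) \<partial>N) sums (\<integral>l. (\<Sum>i. e l * D i l / (l + cnj k)) \<partial>N)"
    proof (rule sums_integral[OF int])
      show "AE l in N. summable (\<lambda>i. norm (e l * D i l / (l + cnj k)))"
        by (intro AE_I2 summable_comparison_test'[OF sum_r, of 0]) (use le in auto)
      show "summable (\<lambda>i. \<integral>l. norm (e l * D i l / (l + cnj k)) \<partial>N)"
      proof (rule summable_comparison_test'[OF sum_r, of 0])
        fix i
        have "(\<integral>l. norm (e l * D i l / (l + cnj k)) \<partial>N) \<le> (\<integral>l. C * r ^ i * (\<kappa> * (cmod (e l) * G l)) \<partial>N)"
          by (intro integral_mono integrable_norm int integrable_mult_right mG' le)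
        also have "\<dots> = C * r ^ i * (\<integral>l. \<kappa> * (cmod (e l) * G l) \<partial>N)" by simp
        finally show "norm (\<integral>l. norm (e l * D i l / (l + cnj k)) \<partial>N) \<le> C * r ^ i * (\<integral>l. \<kappa> * (cmod (e l) * G l) \<partial>N)"
          by simp
      qed
    qed
    moreover have "(\<integral>l. (\<Sum>i. e l * D i l / (l + cnj k)) \<partial>N) = (\<integral>l. e l * \<phi> l / (l + cnj k) \<partial>N)"
    proof (rule Bochner_Integration.integral_cong)
      fix l assume "l \<in> space N"
      then have "(\<lambda>i. e l * D i l / (l + cnj k)) sums (e l * \<phi> l / (l + cnj k))"
        by (intro sums_divide sums_mult D_sums)
      then show "(\<Sum>i. e l * D i l / (l + cnj k)) = e l * \<phi> l / (l + cnj k)"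
        by (rule sums_unique[symmetric])
    qed simp
    ultimately show ?thesis
      unfolding K_def T_def by (intro sums_mult) simp
  qed
  have "A e \<phi> k = f k" if k: "k \<in> space N" for k
  proof -
    \<comment> \<open>The series of shifted increments is summed twice, by the recursion and by
      dropping its first term. Equating the results gives
      \<open>\<epsilon> * A e \<phi> k = \<epsilon> * f k\<close>.\<close>
    have "(\<lambda>n. D (Suc n) k) sums (\<phi> k - of_real \<epsilon> * (\<phi> k + K e \<phi> k))"
      unfolding DS A_def by (intro sums_diff sums_mult sums_add D_sums K_sums k)
    moreover have "(\<lambda>n. D (Suc n) k) sums (\<phi> k - D 0 k)"
      using D_sums[OF k] sums_Suc_iff[of "\<lambda>n. D n k" "\<phi> k - D 0 k"] by simp
    ultimately have "\<phi> k - of_real \<epsilon> * (\<phi> k + K e \<phi> k) = \<phi> k - of_real \<epsilon> * f k"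
      using sums_unique2 by (fastforce simp: D0)
    then show ?thesis using \<epsilon> by (simp add: A_def)
  qed
  with m\<phi> show ?thesis by blast
qed

end

section \<open>The matrix \<open>W\<close> and its dependence on the parameters\<close>

context kp_measure begin

lemma wave_measurable [measurable]: "wave s \<in> borel_measurable N"
  unfolding wave_def[abs_def] phase_def by (cases s) (simp, measurable)

lemma cmod_wave: "cmod (wave s l) = exp (Re (phase s l))"
  by (simp add: wave_def)

lemma moderate_wave [intro, simp]: "moderate (wave s)"
proof (rule moderateI)
  show "cmod (wave s l) \<le> 1 * exp (B * norm s * wt l)" if "l \<in> space N" for l
    using abs_Re_phase_le[OF that, of s] by (simp add: cmod_wave)
qed measurable

lemma moderate_norm [intro]:
  assumes "moderate f"
  shows "moderate (\<lambda>l. of_real (cmod (f l)))"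
  using assms unfolding moderate_def by auto

lemma sq_wave [simp]: "square_integrable N (wave s)"
  by (intro moderate_square_integrable moderate_wave)

text \<open>For \<open>n = 0\<close> this is the right-hand side after the unimodular factor has
  been applied, \<open>E\<close> becoming the conjugate wave. The cases of positive \<open>n\<close>
  arise from differentiation in the parameters.\<close>

definition rhs :: "nat \<Rightarrow> real \<times> real \<times> real \<Rightarrow> complex \<Rightarrow> complex" where
  "rhs n s l = cnj (l ^ n * wave s l)"

lemma moderate_rhs [intro, simp]: "moderate (rhs n s)"
  unfolding rhs_def[abs_def] by (intro moderate_cnj moderate_mult moderate_power moderate_id moderate_wave)

lemma sq_rhs [simp]: "square_integrable N (rhs n s)"
  by (intro moderate_square_integrable moderate_rhs)

text \<open>The choice is made separately for each \<open>s\<close>, so no dependence on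
  \<open>s\<close> is built in; its continuity is derived from the equation alone.\<close>

definition sol :: "nat \<Rightarrow> real \<times> real \<times> real \<Rightarrow> complex \<Rightarrow> complex" where
  "sol m s = (SOME \<phi>. moderate \<phi> \<and> (\<forall>k\<in>space N. A (wave s) \<phi> k = rhs m s k))"

lemma moderate_sol [intro, simp]: "moderate (sol m s)"
  and A_sol: "k \<in> space N \<Longrightarrow> A (wave s) (sol m s) k = rhs m s k"
  using someI_ex[OF A_solvable[OF moderate_wave[of s] moderate_rhs[of m s]]]
  unfolding sol_def[symmetric] by auto

lemma sq_sol [simp]: "square_integrable N (sol m s)"
  by (intro moderate_square_integrable moderate_sol)

lemma ip_A_sol: "ip f (A (wave s) (sol m s)) = ip f (rhs m s)"
  unfolding ip_def by (intro Bochner_Integration.integral_cong refl) (simp add: A_sol)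

lemma ip_A_sol_left: "ip (A (wave s) (sol m s)) f = ip (rhs m s) f"
  using ip_A_sol[of f s m] ip_cnj by metis

lemma L2norm_sol_le: "L2norm N (sol m s) \<le> L2norm N (rhs m s)"
proof -
  have "L2norm N (A (wave s) (sol m s)) = L2norm N (rhs m s)"
    unfolding L2norm_def by (intro arg_cong[where f = sqrt] Bochner_Integration.integral_cong refl) (simp add: A_sol)
  with L2norm_le_A[of "wave s" "sol m s"] show ?thesis by simp
qed

definition W :: "nat \<Rightarrow> nat \<Rightarrow> real \<times> real \<times> real \<Rightarrow> complex" where
  "W n m s = ip (rhs n s) (sol m s)"

lemma W_integral: "W n m s = (\<integral>l. l ^ n * (wave s l * sol m s l) \<partial>N)"
  by (simp add: W_def ip_def rhs_def mult.assoc)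

text \<open>Symmetry of \<open>A\<close> carries the inverse from one right-hand side to the other.
  That \<open>W\<close> is Hermitian follows.\<close>

lemma W_eq: "W n m s = ip (sol n s) (rhs m s)"
  using A_symmetric[of "wave s" "sol n s" "sol m s"] by (simp add: W_def ip_A_sol ip_A_sol_left)

lemma W_cnj: "cnj (W n m s) = W m n s"
  using ip_cnj[of "sol m s" "rhs n s"] by (simp add: W_eq[of m n] W_def[of n m])

lemma cmod_W_le: "cmod (W n m s) \<le> L2norm N (rhs n s) * L2norm N (rhs m s)"
proof -
  have "cmod (W n m s) \<le> L2norm N (rhs n s) * L2norm N (sol m s)"
    unfolding W_def by (intro cmod_ip_le) simp_all
  also have "\<dots> \<le> L2norm N (rhs n s) * L2norm N (rhs m s)"
    by (intro mult_left_mono L2norm_sol_le) simp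
  finally show ?thesis .
qed

section \<open>Bounds and differences of the form \<open>Q\<close>\<close>

lemma Q_factor_le:
  assumes "square_integrable N v" "square_integrable N h" "square_integrable N w" "square_integrable N f"
  shows "cmod (Q (\<lambda>l. v l * h l) (\<lambda>l. w l * f l)) \<le> \<kappa> * (L2norm N v * L2norm N h) * (L2norm N w * L2norm N f)"
proof -
  have "cmod (Q (\<lambda>l. v l * h l) (\<lambda>l. w l * f l))
      \<le> \<kappa> * (\<integral>l. cmod (v l * h l) \<partial>N) * (\<integral>l. cmod (w l * f l) \<partial>N)"
    by (intro cmod_Q_le square_integrable_mult assms)
  also have "\<dots> \<le> \<kappa> * (L2norm N v * L2norm N h) * (L2norm N w * L2norm N f)"
    using Cauchy_Schwarz_L2_norm[OF assms(1,2)] Cauchy_Schwarz_L2_norm[OF assms(3,4)] \<kappa>_pos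
    by (intro mult_mono mult_left_mono) (auto simp: norm_mult)
  finally show ?thesis .
qed

lemma Q_factor_diff_left:
  assumes "square_integrable N v" "square_integrable N v'" "square_integrable N h" "integrable N b"
  shows "Q (\<lambda>l. (v l - v' l) * h l) b = Q (\<lambda>l. v l * h l) b - Q (\<lambda>l. v' l * h l) b"
proof -
  have "(\<lambda>l. v l * h l) = (\<lambda>l. (v l - v' l) * h l + v' l * h l)" by (simp add: algebra_simps)
  then have "Q (\<lambda>l. v l * h l) b = Q (\<lambda>l. (v l - v' l) * h l) b + Q (\<lambda>l. v' l * h l) b"
    by (simp only:) (intro Q_add_left square_integrable_mult square_integrable_diff assms)
  then show ?thesis by simp
qed

lemma Q_factor_diff_right:
  assumes "square_integrable N v" "square_integrable N v'" "square_integrable N h" "integrable N a"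
  shows "Q a (\<lambda>l. (v l - v' l) * h l) = Q a (\<lambda>l. v l * h l) - Q a (\<lambda>l. v' l * h l)"
proof -
  have "(\<lambda>l. v l * h l) = (\<lambda>l. (v l - v' l) * h l + v' l * h l)" by (simp add: algebra_simps)
  then have "Q a (\<lambda>l. v l * h l) = Q a (\<lambda>l. (v l - v' l) * h l) + Q a (\<lambda>l. v' l * h l)"
    by (simp only:) (intro Q_add_right square_integrable_mult square_integrable_diff assms)
  then show ?thesis by simp
qed

lemma Q_factor_diff_left':
  assumes "square_integrable N v" "square_integrable N h" "square_integrable N h'" "integrable N b"
  shows "Q (\<lambda>l. v l * (h l - h' l)) b = Q (\<lambda>l. v l * h l) b - Q (\<lambda>l. v l * h' l) b"
  using Q_factor_diff_left[OF assms(2,3,1,4)] by (simp only: mult.commute)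

text \<open>The discrete product rule for replacing \<open>e\<close> by \<open>e'\<close> in both
  arguments, first in the left one and then in the right one.\<close>

lemma Q_change_left:
  assumes "square_integrable N e" "square_integrable N e'" "square_integrable N a" "square_integrable N b"
  shows "Q (\<lambda>l. e' l * a l) (\<lambda>l. e' l * b l) - Q (\<lambda>l. e l * a l) (\<lambda>l. e l * b l)
    = Q (\<lambda>l. (e' l - e l) * a l) (\<lambda>l. e' l * b l) + Q (\<lambda>l. e l * a l) (\<lambda>l. (e' l - e l) * b l)"
  by (simp add: Q_factor_diff_left Q_factor_diff_right square_integrable_mult assms)

section \<open>Taylor bounds for the waves in the parameters\<close>

definition majorant :: "nat \<Rightarrow> nat \<Rightarrow> real \<times> real \<times> real \<Rightarrow> complex \<Rightarrow> complex" where
  "majorant n j s l =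
     of_real (cmod l ^ n * (cmod l + cmod l ^ 2 + cmod l ^ 3) ^ j * cmod (wave s l) * exp (B * wt l))"

text \<open>One function, independent of the increment, dominates every Taylor estimate of order
  \<open>j\<close> with \<open>norm d \<le> 1\<close>: the polynomial bounds
  \<open>|phase d l|\<close> per unit of \<open>norm d\<close>, and \<open>exp (B * wt l)\<close>
  absorbs \<open>exp |Re (phase d l)|\<close>.\<close>

lemma sq_majorant [simp]: "square_integrable N (majorant n j s)"
proof (rule moderate_square_integrable)
  have "moderate (\<lambda>l. of_real (exp (B * wt l)))"
    by (rule moderateI[of _ 1 B]) simp_all
  then show "moderate (majorant n j s)"
    unfolding majorant_def[abs_def] of_real_mult of_real_power of_real_add
    by (intro moderate_mult moderate_power moderate_add moderate_norm moderate_id moderate_wave)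
qed

lemma cmod_majorant:
  "cmod (majorant n j s l)
    = cmod l ^ n * (cmod l + cmod l ^ 2 + cmod l ^ 3) ^ j * cmod (wave s l) * exp (B * wt l)"
  unfolding majorant_def norm_of_real by (simp add: abs_mult)

lemma cmod_phase_le: "cmod (phase d l) \<le> norm d * (cmod l + cmod l ^ 2 + cmod l ^ 3)"
proof -
  obtain x y t where d: "d = (x, y, t)" by (cases d)
  have nx: "\<bar>x\<bar> \<le> norm d" and ny: "\<bar>y\<bar> \<le> norm d" and nt: "\<bar>t\<bar> \<le> norm d"
    using norm_fst_le[of x "(y, t)"] norm_snd_le[of "(y, t)" x] norm_fst_le[of y t] norm_snd_le[of t y]
    by (auto simp: d)
  have "cmod (phase d l) \<le> cmod (of_real x * l) + cmod (\<i> * of_real y * l\<^sup>2) + cmod (of_real t * l ^ 3)"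
    unfolding d phase_def prod.case
    by (intro norm_triangle_le_diff order_trans[OF norm_triangle_ineq4] add_mono order_refl)
  also have "\<dots> \<le> norm d * cmod l + norm d * cmod l ^ 2 + norm d * cmod l ^ 3"
    unfolding norm_mult norm_power norm_of_real using nx ny nt
    by (intro add_mono mult_right_mono) auto
  finally show ?thesis by (simp add: algebra_simps)
qed

lemma exp_abs_Re_phase_le:
  assumes "norm d \<le> 1" "l \<in> space N"
  shows "exp \<bar>Re (phase d l)\<bar> \<le> exp (B * wt l)"
proof -
  have "B * norm d * wt l \<le> B * 1 * wt l"
    using B_pos wt_nonneg[OF assms(2)] assms(1) by (intro mult_right_mono mult_left_mono) auto
  with abs_Re_phase_le[OF assms(2), of d] show ?thesis by simp
qed

lemma cmod_wave_add_le:
  assumes "norm d \<le> 1" "l \<in> space N"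
  shows "cmod (l ^ n * wave (s + d) l) \<le> 1 * cmod (majorant n 0 s l)"
proof -
  have "exp (Re (phase d l)) \<le> exp (B * wt l)"
    using exp_abs_Re_phase_le[OF assms] abs_ge_self[of "Re (phase d l)"] by (meson exp_le_cancel_iff order_trans)
  then show ?thesis
    by (auto simp: norm_mult norm_power cmod_majorant wave_def phase_add exp_add mult.assoc intro!: mult_left_mono)
qed

text \<open>The Taylor bound has to carry \<open>exp |Re z|\<close> and not \<open>exp |z|\<close>:
  along large imaginary parts with bounded \<open>Re l\<close>, the phase can grow like
  \<open>|l|^3\<close> while \<open>wt\<close> grows only like \<open>|l|^2\<close>, so
  \<open>exp |z|\<close> need not be moderate.\<close>

lemma cmod_wave_add_diff_le:
  assumes "norm d \<le> 1" "l \<in> space N"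
  shows "cmod (l ^ n * (wave (s + d) l - wave s l)) \<le> norm d * cmod (majorant n 1 s l)"
proof -
  have "cmod (exp (phase d l) - 1) \<le> exp \<bar>Re (phase d l)\<bar> * cmod (phase d l)"
    using Taylor_exp[of "phase d l" 0] by simp
  also have "\<dots> \<le> exp (B * wt l) * (norm d * (cmod l + cmod l ^ 2 + cmod l ^ 3))"
    by (intro mult_mono exp_abs_Re_phase_le assms cmod_phase_le) auto
  finally have "cmod (l ^ n * wave s l) * cmod (exp (phase d l) - 1)
      \<le> cmod (l ^ n * wave s l) * (exp (B * wt l) * (norm d * (cmod l + cmod l ^ 2 + cmod l ^ 3)))"
    by (intro mult_left_mono) auto
  moreover have "l ^ n * (wave (s + d) l - wave s l) = l ^ n * wave s l * (exp (phase d l) - 1)"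
    by (simp add: wave_def phase_add exp_add algebra_simps)
  ultimately show ?thesis
    by (simp only: norm_mult norm_power cmod_majorant power_one_right mult_ac)
qed

lemma cmod_wave_add_diff2_le:
  assumes "norm d \<le> 1" "l \<in> space N"
  shows "cmod (l ^ n * (wave (s + d) l - wave s l - wave s l * phase d l)) \<le> (norm d)\<^sup>2 * cmod (majorant n 2 s l)"
proof -
  have "cmod (exp (phase d l) - 1 - phase d l) \<le> exp \<bar>Re (phase d l)\<bar> * (cmod (phase d l))\<^sup>2"
    using Taylor_exp[of "phase d l" 1] by (simp add: power2_eq_square algebra_simps)
  also have "\<dots> \<le> exp (B * wt l) * (norm d * (cmod l + cmod l ^ 2 + cmod l ^ 3))\<^sup>2"
    by (intro mult_mono power_mono exp_abs_Re_phase_le assms cmod_phase_le) auto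
  finally have "cmod (l ^ n * wave s l) * cmod (exp (phase d l) - 1 - phase d l)
      \<le> cmod (l ^ n * wave s l) * (exp (B * wt l) * (norm d * (cmod l + cmod l ^ 2 + cmod l ^ 3))\<^sup>2)"
    by (intro mult_left_mono) auto
  moreover have "l ^ n * (wave (s + d) l - wave s l - wave s l * phase d l)
      = l ^ n * wave s l * (exp (phase d l) - 1 - phase d l)"
    by (simp add: wave_def phase_add exp_add algebra_simps)
  ultimately show ?thesis
    by (simp only: norm_mult norm_power cmod_majorant power_mult_distrib mult_ac)
qed

lemma cmod_wave_phase_le:
  assumes "l \<in> space N"
  shows "cmod (l ^ n * (wave s l * phase d l)) \<le> norm d * cmod (majorant n 1 s l)"
proof -
  have "cmod (l ^ n * wave s l) * cmod (phase d l) * 1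
      \<le> cmod (l ^ n * wave s l) * (norm d * (cmod l + cmod l ^ 2 + cmod l ^ 3)) * exp (B * wt l)"
    using B_pos wt_nonneg[OF assms] by (intro mult_mono mult_left_mono cmod_phase_le) auto
  then show ?thesis
    by (simp only: norm_mult norm_power cmod_majorant power_one_right mult_ac mult_1_right)
qed

lemma moderate_phase [intro, simp]: "moderate (phase d)"
  unfolding phase_def
  by (cases d) (simp, intro moderate_diff moderate_mult moderate_const moderate_power moderate_id)

abbreviation M :: "nat \<Rightarrow> nat \<Rightarrow> real \<times> real \<times> real \<Rightarrow> real" where
  "M n j s \<equiv> L2norm N (majorant n j s)"

text \<open>The second index of \<open>M\<close> is the power of \<open>norm d\<close> gained: 0 for
  sizes, 1 for differences and linear terms, 2 for remainders after the linear term.\<close>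

lemma L2norm_estimates:
  assumes "norm d \<le> 1"
  shows "L2norm N (rhs n (s + d)) \<le> M n 0 s"
    and "L2norm N (wave (s + d)) \<le> M 0 0 s"
    and "L2norm N (\<lambda>l. rhs n (s + d) l - rhs n s l) \<le> norm d * M n 1 s"
    and "L2norm N (\<lambda>l. wave (s + d) l - wave s l) \<le> norm d * M 0 1 s"
    and "L2norm N (\<lambda>l. rhs n (s + d) l - rhs n s l - cnj (l ^ n * (wave s l * phase d l))) \<le> (norm d)\<^sup>2 * M n 2 s"
    and "L2norm N (\<lambda>l. wave (s + d) l - wave s l - wave s l * phase d l) \<le> (norm d)\<^sup>2 * M 0 2 s"
    and "L2norm N (\<lambda>l. cnj (l ^ n * (wave s l * phase d l))) \<le> norm d * M n 1 s"
proof -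
  note [measurable] = moderate_measurable[OF moderate_phase]
  have [measurable]: "rhs n s \<in> borel_measurable N" for n s by (rule moderate_measurable) simp
  have "L2norm N (rhs n (s + d)) \<le> 1 * M n 0 s"
    by (rule L2norm_bound) (simp_all, use cmod_wave_add_le[OF assms] in \<open>simp add: rhs_def norm_mult norm_power\<close>)
  then show "L2norm N (rhs n (s + d)) \<le> M n 0 s" by simp
  have "L2norm N (wave (s + d)) \<le> 1 * M 0 0 s"
    by (rule L2norm_bound) (use cmod_wave_add_le[OF assms, of _ 0] in simp_all)
  then show "L2norm N (wave (s + d)) \<le> M 0 0 s" by simp
  have "cmod (rhs n (s + d) l - rhs n s l) = cmod (l ^ n * (wave (s + d) l - wave s l))" for l
    unfolding rhs_def complex_cnj_diff[symmetric] complex_mod_cnj right_diff_distrib by (rule refl)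
  then show "L2norm N (\<lambda>l. rhs n (s + d) l - rhs n s l) \<le> norm d * M n 1 s"
    by (intro L2norm_bound) (use cmod_wave_add_diff_le[OF assms] in simp_all)
  show "L2norm N (\<lambda>l. wave (s + d) l - wave s l) \<le> norm d * M 0 1 s"
    by (rule L2norm_bound) (use cmod_wave_add_diff_le[OF assms, of _ 0] in simp_all)
  have "cmod (rhs n (s + d) l - rhs n s l - cnj (l ^ n * (wave s l * phase d l)))
      = cmod (l ^ n * (wave (s + d) l - wave s l - wave s l * phase d l))" for l
    unfolding rhs_def complex_cnj_diff[symmetric] complex_mod_cnj right_diff_distrib by (rule refl)
  then show "L2norm N (\<lambda>l. rhs n (s + d) l - rhs n s l - cnj (l ^ n * (wave s l * phase d l))) \<le> (norm d)\<^sup>2 * M n 2 s"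
    by (intro L2norm_bound) (use cmod_wave_add_diff2_le[OF assms] in simp_all)
  show "L2norm N (\<lambda>l. wave (s + d) l - wave s l - wave s l * phase d l) \<le> (norm d)\<^sup>2 * M 0 2 s"
    by (rule L2norm_bound) (use cmod_wave_add_diff2_le[OF assms, of _ 0] in simp_all)
  show "L2norm N (\<lambda>l. cnj (l ^ n * (wave s l * phase d l))) \<le> norm d * M n 1 s"
    by (rule L2norm_bound) (use cmod_wave_phase_le[of _ n s d] in \<open>simp_all del: complex_cnj_mult complex_cnj_power\<close>)
qed

lemma L2norm_wave_le: "L2norm N (wave s) \<le> M 0 0 s"
  using L2norm_estimates(2)[of 0 s] by simp

lemma L2norm_sol_le_M: "norm d \<le> 1 \<Longrightarrow> L2norm N (sol n (s + d)) \<le> M n 0 s"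
  using L2norm_sol_le L2norm_estimates(1) order_trans by blast

lemma L2norm_sol_le_M0: "L2norm N (sol n s) \<le> M n 0 s"
  using L2norm_sol_le_M[of 0 n s] by simp

lemma Q_le:
  assumes "square_integrable N v" "square_integrable N h" "square_integrable N w" "square_integrable N f"
    and "L2norm N v \<le> a" "L2norm N h \<le> b" "L2norm N w \<le> c" "L2norm N f \<le> d"
  shows "cmod (Q (\<lambda>l. v l * h l) (\<lambda>l. w l * f l)) \<le> \<kappa> * (a * b) * (c * d)"
proof -
  have nn: "0 \<le> a" "0 \<le> b" "0 \<le> c" "0 \<le> d"
    using assms(5-8) L2norm_nonneg order_trans by blast+
  have "cmod (Q (\<lambda>l. v l * h l) (\<lambda>l. w l * f l)) \<le> \<kappa> * (L2norm N v * L2norm N h) * (L2norm N w * L2norm N f)"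
    by (rule Q_factor_le[OF assms(1-4)])
  also have "\<dots> \<le> \<kappa> * (a * b) * (c * d)"
    using \<kappa>_pos nn assms(5-8) by (intro mult_mono mult_left_mono) auto
  finally show ?thesis .
qed

lemma ip_le:
  assumes "square_integrable N f" "square_integrable N h" "L2norm N f \<le> a" "L2norm N h \<le> b"
  shows "cmod (ip f h) \<le> a * b"
proof -
  have "0 \<le> a" using assms(3) L2norm_nonneg order_trans by blast
  then have "L2norm N f * L2norm N h \<le> a * b"
    using assms(3,4) by (intro mult_mono) auto
  with cmod_ip_le[OF assms(1,2)] show ?thesis by linarith
qed

text \<open>Coercivity of the operator at the new parameter is applied to the difference
  \<open>\<Delta>\<close> of the solutions. Both equations turn
  \<open>ip \<Delta> (A e' \<Delta>)\<close> into terms with one factor that differences the data,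
  each at most a constant times \<open>norm d * L2norm N \<Delta>\<close>; one factor
  \<open>L2norm N \<Delta>\<close> then cancels.\<close>

lemma sol_lipschitz:
  "\<exists>L. \<forall>d. norm d \<le> 1 \<longrightarrow> L2norm N (\<lambda>l. sol m (s + d) l - sol m s l) \<le> norm d * L"
proof (intro exI allI impI)
  fix d :: "real \<times> real \<times> real" assume d: "norm d \<le> 1"
  define h h' where "h = sol m s" and "h' = sol m (s + d)"
  define \<Delta> where "\<Delta> = (\<lambda>l. h' l - h l)"
  define e e' where "e = wave s" and "e' = wave (s + d)"
  have sq [simp]: "square_integrable N h" "square_integrable N h'" "square_integrable N \<Delta>"
      "square_integrable N e" "square_integrable N e'" "square_integrable N (\<lambda>l. e' l - e l)"
    by (auto simp: h_def h'_def \<Delta>_def e_def e'_def intro!: square_integrable_diff)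
  have "ip \<Delta> (A e' \<Delta>) = ip \<Delta> \<Delta> + Q (\<lambda>l. e' l * \<Delta> l) (\<lambda>l. e' l * \<Delta> l)"
    by (intro ip_A sq)
  also have "\<dots> = (ip \<Delta> h' + Q (\<lambda>l. e' l * h' l) (\<lambda>l. e' l * \<Delta> l)) - (ip \<Delta> h + Q (\<lambda>l. e' l * h l) (\<lambda>l. e' l * \<Delta> l))"
  proof -
    have "ip \<Delta> \<Delta> = ip \<Delta> h' - ip \<Delta> h"
      by (subst (2) \<Delta>_def) (intro ip_diff_right sq)
    moreover have "Q (\<lambda>l. e' l * \<Delta> l) (\<lambda>l. e' l * \<Delta> l) = Q (\<lambda>l. e' l * h' l) (\<lambda>l. e' l * \<Delta> l) - Q (\<lambda>l. e' l * h l) (\<lambda>l. e' l * \<Delta> l)"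
      by (subst (1) \<Delta>_def) (intro Q_factor_diff_left' sq square_integrable_mult)
    ultimately show ?thesis by simp
  qed
  also have "ip \<Delta> h' + Q (\<lambda>l. e' l * h' l) (\<lambda>l. e' l * \<Delta> l) = ip \<Delta> (rhs m (s + d))"
    using ip_A_sol[of \<Delta> "s + d" m] ip_A[of e' \<Delta> h'] by (simp add: h'_def e'_def)
  also have "ip \<Delta> h + Q (\<lambda>l. e' l * h l) (\<lambda>l. e' l * \<Delta> l)
      = ip \<Delta> (rhs m s) + (Q (\<lambda>l. e' l * h l) (\<lambda>l. e' l * \<Delta> l) - Q (\<lambda>l. e l * h l) (\<lambda>l. e l * \<Delta> l))"
    using ip_A_sol[of \<Delta> s m] ip_A[of e \<Delta> h] by (simp add: h_def e_def)
  also have "Q (\<lambda>l. e' l * h l) (\<lambda>l. e' l * \<Delta> l) - Q (\<lambda>l. e l * h l) (\<lambda>l. e l * \<Delta> l)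
      = Q (\<lambda>l. (e' l - e l) * h l) (\<lambda>l. e' l * \<Delta> l) + Q (\<lambda>l. e l * h l) (\<lambda>l. (e' l - e l) * \<Delta> l)"
    by (intro Q_change_left sq)
  finally have eq: "ip \<Delta> (A e' \<Delta>) = ip \<Delta> (\<lambda>l. rhs m (s + d) l - rhs m s l)
      - (Q (\<lambda>l. (e' l - e l) * h l) (\<lambda>l. e' l * \<Delta> l) + Q (\<lambda>l. e l * h l) (\<lambda>l. (e' l - e l) * \<Delta> l))"
    by (simp add: ip_diff_right)
  have 1: "cmod (ip \<Delta> (\<lambda>l. rhs m (s + d) l - rhs m s l)) \<le> L2norm N \<Delta> * (norm d * M m 1 s)"
    by (rule ip_le) (auto simp del: One_nat_def intro: square_integrable_diff L2norm_estimates d)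
  have 2: "cmod (Q (\<lambda>l. (e' l - e l) * h l) (\<lambda>l. e' l * \<Delta> l))
      \<le> \<kappa> * ((norm d * M 0 1 s) * M m 0 s) * (M 0 0 s * L2norm N \<Delta>)"
    by (rule Q_le) (auto simp del: One_nat_def simp: e_def e'_def h_def intro: square_integrable_diff L2norm_estimates d L2norm_sol_le_M0)
  have 3: "cmod (Q (\<lambda>l. e l * h l) (\<lambda>l. (e' l - e l) * \<Delta> l))
      \<le> \<kappa> * (M 0 0 s * M m 0 s) * ((norm d * M 0 1 s) * L2norm N \<Delta>)"
    by (rule Q_le) (auto simp del: One_nat_def simp: e_def e'_def h_def intro: square_integrable_diff L2norm_estimates d L2norm_sol_le_M0 L2norm_wave_le)
  define L where "L = M m 1 s + 2 * (\<kappa> * (M 0 1 s * M m 0 s) * M 0 0 s)"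
  have "(L2norm N \<Delta>)\<^sup>2 \<le> cmod (ip \<Delta> (A e' \<Delta>))"
    using A_coercive[of e' \<Delta>] complex_Re_le_cmod[of "ip \<Delta> (A e' \<Delta>)"] by simp
  also have "\<dots> \<le> cmod (ip \<Delta> (\<lambda>l. rhs m (s + d) l - rhs m s l))
      + (cmod (Q (\<lambda>l. (e' l - e l) * h l) (\<lambda>l. e' l * \<Delta> l)) + cmod (Q (\<lambda>l. e l * h l) (\<lambda>l. (e' l - e l) * \<Delta> l)))"
    unfolding eq by (intro order_trans[OF norm_triangle_ineq4] add_mono norm_triangle_ineq order_refl)
  also have "\<dots> \<le> L2norm N \<Delta> * (norm d * L)"
    using 1 2 3 by (simp add: L_def algebra_simps)
  finally have "L2norm N \<Delta> * L2norm N \<Delta> \<le> L2norm N \<Delta> * (norm d * L)"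
    by (simp add: power2_eq_square)
  moreover have "0 \<le> norm d * L"
    using \<kappa>_pos by (simp add: L_def)
  ultimately have "L2norm N \<Delta> \<le> norm d * L"
    by (cases "L2norm N \<Delta> = 0") (simp_all add: mult_le_cancel_left less_le)
  then show "L2norm N (\<lambda>l. sol m (s + d) l - sol m s l) \<le> norm d * (M m 1 s + 2 * (\<kappa> * (M 0 1 s * M m 0 s) * M 0 0 s))"
    by (simp add: \<Delta>_def h_def h'_def L_def)
qed

text \<open>A weak resolvent identity. The old solution for \<open>n\<close> is tested against the
  new one for \<open>m\<close>, and the mixed term \<open>ip (sol n s) (sol m s')\<close> cancels.
  No difference of solutions is left, which is why a Lipschitz bound for \<open>sol\<close> is
  enough below.\<close>

lemma W_diff:
  "W n m s' - W n m s = ip (\<lambda>l. rhs n s' l - rhs n s l) (sol m s') + ip (sol n s) (\<lambda>l. rhs m s' l - rhs m s l)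
    - (Q (\<lambda>l. wave s' l * sol m s' l) (\<lambda>l. wave s' l * sol n s l) - Q (\<lambda>l. wave s l * sol m s' l) (\<lambda>l. wave s l * sol n s l))"
proof -
  have "ip (sol n s) (rhs m s') = ip (sol n s) (sol m s') + Q (\<lambda>l. wave s' l * sol m s' l) (\<lambda>l. wave s' l * sol n s l)"
    using ip_A[of "wave s'" "sol n s" "sol m s'"] by (simp add: ip_A_sol)
  moreover have "ip (rhs n s) (sol m s') = ip (sol n s) (sol m s') + Q (\<lambda>l. wave s l * sol m s' l) (\<lambda>l. wave s l * sol n s l)"
    using ip_A[of "wave s" "sol n s" "sol m s'"] A_symmetric[of "wave s" "sol n s" "sol m s'"]
    by (simp add: ip_A_sol_left)
  moreover have "W n m s' = ip (rhs n s') (sol m s')" "W n m s = ip (sol n s) (rhs m s)"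
    by (simp_all add: W_def[of n m s'] W_eq[of n m s])
  ultimately show ?thesis
    by (simp add: ip_diff_left ip_diff_right)
qed

text \<open>The linear part in \<open>d\<close> of the right-hand side of \<open>W_diff\<close>:
  each difference of data is replaced by its linear term, and the solutions are taken at
  \<open>s\<close>.\<close>

definition DW :: "nat \<Rightarrow> nat \<Rightarrow> real \<times> real \<times> real \<Rightarrow> real \<times> real \<times> real \<Rightarrow> complex" where
  "DW n m s d = ip (\<lambda>l. cnj (l ^ n * (wave s l * phase d l))) (sol m s)
     + ip (sol n s) (\<lambda>l. cnj (l ^ m * (wave s l * phase d l)))
     - (Q (\<lambda>l. (wave s l * phase d l) * sol m s l) (\<lambda>l. wave s l * sol n s l)
        + Q (\<lambda>l. wave s l * sol m s l) (\<lambda>l. (wave s l * phase d l) * sol n s l))"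

lemma W_remainder:
  "\<exists>C. \<forall>d. norm d \<le> 1 \<longrightarrow> cmod (W n m (s + d) - W n m s - DW n m s d) \<le> (norm d)\<^sup>2 * C"
proof -
  obtain L where L: "\<And>d. norm d \<le> 1 \<Longrightarrow> L2norm N (\<lambda>l. sol m (s + d) l - sol m s l) \<le> norm d * L"
    using sol_lipschitz by blast
  have "cmod (W n m (s + d) - W n m s - DW n m s d) \<le> (norm d)\<^sup>2 *
      (M n 2 s * M m 0 s + M n 1 s * L + M n 0 s * M m 2 s
       + \<kappa> * (M 0 1 s * M m 0 s) * (M 0 1 s * M n 0 s)
       + \<kappa> * (M 0 1 s * L) * (M 0 0 s * M n 0 s)
       + \<kappa> * (M 0 2 s * M m 0 s) * (M 0 0 s * M n 0 s)
       + \<kappa> * (M 0 0 s * L) * (M 0 1 s * M n 0 s)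
       + \<kappa> * (M 0 0 s * M m 0 s) * (M 0 2 s * M n 0 s))" if d: "norm d \<le> 1" for d
  proof -
    define h h' \<eta> where "h = sol m s" and "h' = sol m (s + d)" and "\<eta> = sol n s"
    define \<Delta> where "\<Delta> = (\<lambda>l. h' l - h l)"
    define e e' where "e = wave s" and "e' = wave (s + d)"
    define e1 where "e1 = (\<lambda>l. e' l - e l)"
    define a where "a = (\<lambda>l. e l * phase d l)"
    define r where "r = (\<lambda>l. e1 l - a l)"
    define gn where "gn = (\<lambda>l. cnj (l ^ n * a l))"
    define gm where "gm = (\<lambda>l. cnj (l ^ m * a l))"
    define Rn where "Rn = (\<lambda>l. rhs n (s + d) l - rhs n s l)"
    define Rm where "Rm = (\<lambda>l. rhs m (s + d) l - rhs m s l)"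
    have ma: "moderate a" by (auto simp: a_def e_def)
    then have sqa: "square_integrable N a" "square_integrable N gn" "square_integrable N gm"
      by (auto simp: gn_def gm_def simp del: complex_cnj_mult complex_cnj_power
        intro!: moderate_square_integrable moderate_cnj moderate_mult moderate_power)
    have sq [simp]: "square_integrable N h" "square_integrable N h'" "square_integrable N \<eta>" "square_integrable N \<Delta>"
      "square_integrable N e" "square_integrable N e'" "square_integrable N e1" "square_integrable N a"
      "square_integrable N r" "square_integrable N gn" "square_integrable N gm"
      "square_integrable N Rn" "square_integrable N Rm" "square_integrable N (\<lambda>l. Rn l - gn l)" "square_integrable N (\<lambda>l. Rm l - gm l)"
      using sqa by (auto simp: h_def h'_def \<eta>_def \<Delta>_def e_def e'_def e1_def r_def Rn_def Rm_def intro!: square_integrable_diff)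
    note [simp] = square_integrable_mult
    note est = L2norm_estimates[OF d]
    have le: "L2norm N h \<le> M m 0 s" "L2norm N h' \<le> M m 0 s" "L2norm N \<eta> \<le> M n 0 s" "L2norm N \<Delta> \<le> norm d * L"
      "L2norm N e \<le> M 0 0 s" "L2norm N e1 \<le> norm d * M 0 1 s" "L2norm N r \<le> (norm d)\<^sup>2 * M 0 2 s"
      "L2norm N gn \<le> norm d * M n 1 s" "L2norm N (\<lambda>l. Rn l - gn l) \<le> (norm d)\<^sup>2 * M n 2 s"
      "L2norm N (\<lambda>l. Rm l - gm l) \<le> (norm d)\<^sup>2 * M m 2 s"
      using L2norm_sol_le_M0[of m s] L2norm_sol_le_M0[of n s] L2norm_sol_le_M[OF d, of m s] L[OF d] L2norm_wave_le[of s]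
        est(4)[of s] est(6)[of s] est(7)[of n s] est(5)[of n s] est(5)[of m s]
      by (simp_all only: h_def h'_def \<eta>_def \<Delta>_def e_def e'_def e1_def r_def gn_def gm_def Rn_def Rm_def a_def)
    have "W n m (s + d) - W n m s = ip Rn h' + ip \<eta> Rm - (Q (\<lambda>l. e' l * h' l) (\<lambda>l. e' l * \<eta> l) - Q (\<lambda>l. e l * h' l) (\<lambda>l. e l * \<eta> l))"
      unfolding W_diff by (simp only: h'_def \<eta>_def e_def e'_def Rn_def Rm_def)
    moreover have "DW n m s d = ip gn h + ip \<eta> gm - (Q (\<lambda>l. a l * h l) (\<lambda>l. e l * \<eta> l) + Q (\<lambda>l. e l * h l) (\<lambda>l. a l * \<eta> l))"
      by (simp only: DW_def h_def \<eta>_def e_def a_def gn_def gm_def)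
    moreover have "ip Rn h' - ip gn h = ip (\<lambda>l. Rn l - gn l) h' + ip gn \<Delta>"
      by (simp add: ip_diff_left ip_diff_right \<Delta>_def)
    moreover have "ip \<eta> Rm - ip \<eta> gm = ip \<eta> (\<lambda>l. Rm l - gm l)"
      by (simp add: ip_diff_right)
    \<comment> \<open>Insert \<open>e' = e + e1\<close>, \<open>h' = h + \<Delta>\<close> and
      \<open>e1 = a + r\<close>. Every surviving term contains two first-order quantities among
      \<open>e1\<close> and \<open>\<Delta>\<close>, or the second-order remainder
      \<open>r\<close>.\<close>
    moreover have "Q (\<lambda>l. e' l * h' l) (\<lambda>l. e' l * \<eta> l) - Q (\<lambda>l. e l * h' l) (\<lambda>l. e l * \<eta> l)
        - (Q (\<lambda>l. a l * h l) (\<lambda>l. e l * \<eta> l) + Q (\<lambda>l. e l * h l) (\<lambda>l. a l * \<eta> l))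
      = Q (\<lambda>l. e1 l * h' l) (\<lambda>l. e1 l * \<eta> l) + Q (\<lambda>l. e1 l * \<Delta> l) (\<lambda>l. e l * \<eta> l) + Q (\<lambda>l. r l * h l) (\<lambda>l. e l * \<eta> l)
        + Q (\<lambda>l. e l * \<Delta> l) (\<lambda>l. e1 l * \<eta> l) + Q (\<lambda>l. e l * h l) (\<lambda>l. r l * \<eta> l)"
    proof -
      have "Q (\<lambda>l. e' l * h' l) (\<lambda>l. e' l * \<eta> l) - Q (\<lambda>l. e l * h' l) (\<lambda>l. e l * \<eta> l)
          = Q (\<lambda>l. e1 l * h' l) (\<lambda>l. e' l * \<eta> l) + Q (\<lambda>l. e l * h' l) (\<lambda>l. e1 l * \<eta> l)"
        unfolding e1_def by (intro Q_change_left sq)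
      moreover have "Q (\<lambda>l. e1 l * h' l) (\<lambda>l. e1 l * \<eta> l) = Q (\<lambda>l. e1 l * h' l) (\<lambda>l. e' l * \<eta> l) - Q (\<lambda>l. e1 l * h' l) (\<lambda>l. e l * \<eta> l)"
        by (subst (2) e1_def) (intro Q_factor_diff_right sq square_integrable_mult)
      moreover have "Q (\<lambda>l. e1 l * \<Delta> l) (\<lambda>l. e l * \<eta> l) = Q (\<lambda>l. e1 l * h' l) (\<lambda>l. e l * \<eta> l) - Q (\<lambda>l. e1 l * h l) (\<lambda>l. e l * \<eta> l)"
        unfolding \<Delta>_def by (intro Q_factor_diff_left' sq square_integrable_mult)
      moreover have "Q (\<lambda>l. r l * h l) (\<lambda>l. e l * \<eta> l) = Q (\<lambda>l. e1 l * h l) (\<lambda>l. e l * \<eta> l) - Q (\<lambda>l. a l * h l) (\<lambda>l. e l * \<eta> l)"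
        unfolding r_def by (intro Q_factor_diff_left sq square_integrable_mult)
      moreover have "Q (\<lambda>l. e l * \<Delta> l) (\<lambda>l. e1 l * \<eta> l) = Q (\<lambda>l. e l * h' l) (\<lambda>l. e1 l * \<eta> l) - Q (\<lambda>l. e l * h l) (\<lambda>l. e1 l * \<eta> l)"
        unfolding \<Delta>_def by (intro Q_factor_diff_left' sq square_integrable_mult)
      moreover have "Q (\<lambda>l. e l * h l) (\<lambda>l. r l * \<eta> l) = Q (\<lambda>l. e l * h l) (\<lambda>l. e1 l * \<eta> l) - Q (\<lambda>l. e l * h l) (\<lambda>l. a l * \<eta> l)"
        unfolding r_def by (intro Q_factor_diff_right sq square_integrable_mult)
      ultimately show ?thesis by simp
    qed
    ultimately have eq: "W n m (s + d) - W n m s - DW n m s d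
      = ip (\<lambda>l. Rn l - gn l) h' + ip gn \<Delta> + ip \<eta> (\<lambda>l. Rm l - gm l)
        - (Q (\<lambda>l. e1 l * h' l) (\<lambda>l. e1 l * \<eta> l) + Q (\<lambda>l. e1 l * \<Delta> l) (\<lambda>l. e l * \<eta> l) + Q (\<lambda>l. r l * h l) (\<lambda>l. e l * \<eta> l)
        + Q (\<lambda>l. e l * \<Delta> l) (\<lambda>l. e1 l * \<eta> l) + Q (\<lambda>l. e l * h l) (\<lambda>l. r l * \<eta> l))"
      by (simp only:) (simp add: algebra_simps)
    have tri: "cmod (z1 + z2 + z3 - (z4 + z5 + z6 + z7 + z8)) \<le> b1 + b2 + b3 + b4 + b5 + b6 + b7 + b8"
      if "cmod z1 \<le> b1" "cmod z2 \<le> b2" "cmod z3 \<le> b3" "cmod z4 \<le> b4" "cmod z5 \<le> b5" "cmod z6 \<le> b6" "cmod z7 \<le> b7" "cmod z8 \<le> b8"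
      for z1 z2 z3 z4 z5 z6 z7 z8 b1 b2 b3 b4 b5 b6 b7 b8
    proof -
      have "cmod (z1 + z2 + z3) \<le> b1 + b2 + b3" "cmod (z4 + z5 + z6 + z7 + z8) \<le> b4 + b5 + b6 + b7 + b8"
        by (intro norm_triangle_le add_mono that)+
      with norm_triangle_ineq4[of "z1 + z2 + z3" "z4 + z5 + z6 + z7 + z8"] show ?thesis by linarith
    qed
    have "cmod (W n m (s + d) - W n m s - DW n m s d) \<le> (norm d)\<^sup>2 * M n 2 s * M m 0 s
      + norm d * M n 1 s * (norm d * L) + M n 0 s * ((norm d)\<^sup>2 * M m 2 s)
      + \<kappa> * ((norm d * M 0 1 s) * M m 0 s) * ((norm d * M 0 1 s) * M n 0 s)
      + \<kappa> * ((norm d * M 0 1 s) * (norm d * L)) * (M 0 0 s * M n 0 s)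
      + \<kappa> * (((norm d)\<^sup>2 * M 0 2 s) * M m 0 s) * (M 0 0 s * M n 0 s)
      + \<kappa> * (M 0 0 s * (norm d * L)) * ((norm d * M 0 1 s) * M n 0 s)
      + \<kappa> * (M 0 0 s * M m 0 s) * (((norm d)\<^sup>2 * M 0 2 s) * M n 0 s)"
      unfolding eq by (intro tri ip_le Q_le le sq)
    then show ?thesis by (simp add: algebra_simps power2_eq_square)
  qed
  then show ?thesis by blast
qed

end

section \<open>The derivatives of \<open>W\<close>\<close>

context kp_measure begin

lemma integral_linear3:
  fixes f0 f1 f2 :: "complex \<Rightarrow> complex"
  assumes "integrable N f0" "integrable N f1" "integrable N f2"
  shows "(\<integral>l. c0 * f0 l + c1 * f1 l - c2 * f2 l \<partial>N)
    = c0 * (\<integral>l. f0 l \<partial>N) + c1 * (\<integral>l. f1 l \<partial>N) - c2 * (\<integral>l. f2 l \<partial>N)"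
  using assms by simp

lemma integrable_W [simp]: "integrable N (\<lambda>l. l ^ j * (wave s l * sol m s l))"
  by (intro moderate_integrable moderate_mult moderate_power moderate_id moderate_wave moderate_sol)

lemma ip_phase_sol:
  "ip (\<lambda>l. cnj (l ^ n * (wave s l * phase (x, y, t) l))) (sol m s)
    = of_real x * W (Suc n) m s - \<i> * of_real y * W (Suc (Suc n)) m s - of_real t * W (Suc (Suc (Suc n))) m s"
proof -
  have "ip (\<lambda>l. cnj (l ^ n * (wave s l * phase (x, y, t) l))) (sol m s)
    = (\<integral>l. of_real x * (l ^ Suc n * (wave s l * sol m s l)) - \<i> * of_real y * (l ^ Suc (Suc n) * (wave s l * sol m s l))
        - of_real t * (l ^ Suc (Suc (Suc n)) * (wave s l * sol m s l)) \<partial>N)"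
    unfolding ip_def phase_def prod.case complex_cnj_cnj
    by (intro Bochner_Integration.integral_cong refl) (simp add: algebra_simps power2_eq_square power3_eq_cube)
  also have "\<dots> = of_real x * W (Suc n) m s - \<i> * of_real y * W (Suc (Suc n)) m s - of_real t * W (Suc (Suc (Suc n))) m s"
    by (simp add: W_integral del: power_Suc)
  finally show ?thesis .
qed

lemma ip_sol_phase:
  "ip (sol n s) (\<lambda>l. cnj (l ^ m * (wave s l * phase (x, y, t) l)))
    = of_real x * W n (Suc m) s + \<i> * of_real y * W n (Suc (Suc m)) s - of_real t * W n (Suc (Suc (Suc m))) s"
  using arg_cong[OF ip_phase_sol[of m s x y t n], of cnj]
  unfolding ip_cnj[symmetric] by (simp add: W_cnj)

text \<open>The sum \<open>phase d l + cnj (phase d k)\<close> is divisible by the denominator \<open>l + cnj k\<close>, so the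
  derivative of the kernel has finite rank.\<close>

lemma T_phase:
  assumes k: "k \<in> space N"
  shows "T (\<lambda>l. (wave s l * phase (x, y, t) l) * sol m s l) k + cnj (phase (x, y, t) k) * T (\<lambda>l. wave s l * sol m s l) k
    = (of_real x * W 0 m s - \<i> * of_real y * W 1 m s - of_real t * W 2 m s)
      + (\<i> * of_real y * W 0 m s + of_real t * W 1 m s) * cnj k - of_real t * W 0 m s * (cnj k)\<^sup>2"
proof -
  let ?\<alpha> = "phase (x, y, t)" and ?h = "\<lambda>l. wave s l * sol m s l"
  have int: "integrable N (\<lambda>l. (wave s l * ?\<alpha> l) * sol m s l / (l + cnj k))" "integrable N (\<lambda>l. ?h l / (l + cnj k))"
    by (intro integrable_T moderate_integrable moderate_mult moderate_wave moderate_phase moderate_sol k)+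
  have "T (\<lambda>l. (wave s l * ?\<alpha> l) * sol m s l) k + cnj (?\<alpha> k) * T ?h k
    = (\<integral>l. (wave s l * ?\<alpha> l) * sol m s l / (l + cnj k) + cnj (?\<alpha> k) * (?h l / (l + cnj k)) \<partial>N)"
    unfolding T_def integral_mult_right_zero[symmetric]
    by (rule Bochner_Integration.integral_add[symmetric]; intro integrable_mult_right int)
  also have "\<dots> = (\<integral>l. (of_real x + \<i> * of_real y * cnj k - of_real t * (cnj k)\<^sup>2) * (l ^ 0 * ?h l)
      + (of_real t * cnj k - \<i> * of_real y) * (l ^ 1 * ?h l) - of_real t * (l ^ 2 * ?h l) \<partial>N)"
  proof (intro Bochner_Integration.integral_cong refl)
    fix l assume l: "l \<in> space N"
    have "Re (l + cnj k) > 0" using Re_pos[OF k] Re_pos[OF l] by simp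
    then have ne: "l + cnj k \<noteq> 0" by (metis less_irrefl zero_complex.sel(1))
    have "?\<alpha> l + cnj (?\<alpha> k) = (of_real x + \<i> * of_real y * cnj k - of_real t * (cnj k)\<^sup>2
        + (of_real t * cnj k - \<i> * of_real y) * l - of_real t * l\<^sup>2) * (l + cnj k)"
      by (simp add: phase_def algebra_simps power2_eq_square power3_eq_cube)
    note num = this
    have eq: "(?\<alpha> l + cnj (?\<alpha> k)) / (l + cnj k) = of_real x + \<i> * of_real y * cnj k - of_real t * (cnj k)\<^sup>2
        + (of_real t * cnj k - \<i> * of_real y) * l - of_real t * l\<^sup>2"
      unfolding num by (rule nonzero_mult_div_cancel_right[OF ne])
    have "(wave s l * ?\<alpha> l) * sol m s l / (l + cnj k) + cnj (?\<alpha> k) * (?h l / (l + cnj k))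
        = ((?\<alpha> l + cnj (?\<alpha> k)) / (l + cnj k)) * ?h l"
      by (simp add: algebra_simps add_divide_distrib)
    also have "\<dots> = (of_real x + \<i> * of_real y * cnj k - of_real t * (cnj k)\<^sup>2) * (l ^ 0 * ?h l)
      + (of_real t * cnj k - \<i> * of_real y) * (l ^ 1 * ?h l) - of_real t * (l ^ 2 * ?h l)"
      unfolding eq by (simp add: algebra_simps)
    finally show "(wave s l * ?\<alpha> l) * sol m s l / (l + cnj k) + cnj (?\<alpha> k) * (?h l / (l + cnj k)) = \<dots>" .
  qed
  also have "\<dots> = (of_real x + \<i> * of_real y * cnj k - of_real t * (cnj k)\<^sup>2) * W 0 m s
      + (of_real t * cnj k - \<i> * of_real y) * W 1 m s - of_real t * W 2 m s"
    unfolding W_integral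
    by (rule integral_linear3; rule integrable_W)
  finally show ?thesis by (simp add: algebra_simps)
qed

text \<open>The phase in the second argument comes out conjugated and is exactly the factor
  \<open>cnj (phase d k)\<close> that \<open>T_phase\<close> needs. What remains is quadratic in
  \<open>cnj k\<close> and pairs with the second solution to \<open>W n 0\<close>,
  \<open>W n 1\<close> and \<open>W n 2\<close>.\<close>

lemma Q_phase:
  "Q (\<lambda>l. (wave s l * phase (x, y, t) l) * sol m s l) (\<lambda>l. wave s l * sol n s l)
   + Q (\<lambda>l. wave s l * sol m s l) (\<lambda>l. (wave s l * phase (x, y, t) l) * sol n s l)
   = (of_real x * W 0 m s - \<i> * of_real y * W 1 m s - of_real t * W 2 m s) * W n 0 s
     + (\<i> * of_real y * W 0 m s + of_real t * W 1 m s) * W n 1 s - of_real t * W 0 m s * W n 2 s"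
proof -
  let ?\<alpha> = "phase (x, y, t)" and ?h = "\<lambda>l. wave s l * sol m s l" and ?b = "\<lambda>l. wave s l * sol n s l"
  let ?a = "\<lambda>l. (wave s l * ?\<alpha> l) * sol m s l" and ?c = "\<lambda>l. (wave s l * ?\<alpha> l) * sol n s l"
  define c0 c1 c2 where "c0 = of_real x * W 0 m s - \<i> * of_real y * W 1 m s - of_real t * W 2 m s"
    and "c1 = \<i> * of_real y * W 0 m s + of_real t * W 1 m s" and "c2 = of_real t * W 0 m s"
  have int: "integrable N ?a" "integrable N ?b" "integrable N ?h" "integrable N ?c"
    by (intro moderate_integrable moderate_mult moderate_wave moderate_phase moderate_sol)+
  have intW: "integrable N (\<lambda>k. cnj (k ^ j * ?b k))" for j
    using integrable_cnj[OF integrable_W] by blast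
  have "Q ?a ?b + Q ?h ?c = (\<integral>k. cnj (?b k) * T ?a k + cnj (?c k) * T ?h k \<partial>N)"
    unfolding Q_def by (rule Bochner_Integration.integral_add[symmetric]; intro integrable_Q int)
  also have "\<dots> = (\<integral>k. c0 * cnj (k ^ 0 * ?b k) + c1 * cnj (k ^ 1 * ?b k) - c2 * cnj (k ^ 2 * ?b k) \<partial>N)"
  proof (intro Bochner_Integration.integral_cong refl)
    fix k assume k: "k \<in> space N"
    have "cnj (?b k) * T ?a k + cnj (?c k) * T ?h k = cnj (?b k) * (T ?a k + cnj (?\<alpha> k) * T ?h k)"
      by (simp add: algebra_simps)
    also have "\<dots> = c0 * cnj (k ^ 0 * ?b k) + c1 * cnj (k ^ 1 * ?b k) - c2 * cnj (k ^ 2 * ?b k)"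
      unfolding T_phase[OF k] c0_def[symmetric] c1_def[symmetric] c2_def[symmetric]
      by (simp add: algebra_simps)
    finally show "cnj (?b k) * T ?a k + cnj (?c k) * T ?h k = \<dots>" .
  qed
  also have "\<dots> = c0 * cnj (W 0 n s) + c1 * cnj (W 1 n s) - c2 * cnj (W 2 n s)"
    unfolding W_integral Bochner_Integration.integral_cnj[symmetric]
    by (rule integral_linear3; rule intW)
  finally show ?thesis by (simp add: W_cnj c0_def c1_def c2_def)
qed

text \<open>The \<open>x\<close>-derivative of \<open>W n m\<close>, as \<open>partials_W\<close>
  confirms. The linear terms come from differentiating the two right-hand sides, the product from
  the rank-one \<open>x\<close>-derivative of the kernel; \<open>Wy\<close> and \<open>Wt\<close>
  arise likewise, with ranks two and three.\<close>

definition Wx :: "nat \<Rightarrow> nat \<Rightarrow> real \<times> real \<times> real \<Rightarrow> complex" where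
  "Wx n m s = W (Suc n) m s + W n (Suc m) s - W n 0 s * W 0 m s"

definition Wy :: "nat \<Rightarrow> nat \<Rightarrow> real \<times> real \<times> real \<Rightarrow> complex" where
  "Wy n m s = \<i> * (W n (Suc (Suc m)) s - W (Suc (Suc n)) m s + W n 0 s * W (Suc 0) m s - W n (Suc 0) s * W 0 m s)"

definition Wt :: "nat \<Rightarrow> nat \<Rightarrow> real \<times> real \<times> real \<Rightarrow> complex" where
  "Wt n m s = W n 0 s * W (Suc (Suc 0)) m s - W n (Suc 0) s * W (Suc 0) m s + W n (Suc (Suc 0)) s * W 0 m s
     - W (Suc (Suc (Suc n))) m s - W n (Suc (Suc (Suc m))) s"

lemma DW_eq:
  "DW n m s d = fst d *\<^sub>R Wx n m s + fst (snd d) *\<^sub>R Wy n m s + snd (snd d) *\<^sub>R Wt n m s"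
  by (cases d)
    (simp only: DW_def ip_phase_sol ip_sol_phase Q_phase Wx_def Wy_def Wt_def scaleR_conv_of_real
      fst_conv snd_conv, simp add: eval_nat_numeral algebra_simps)

lemma W_has_derivative:
  "(W n m has_derivative (\<lambda>d. fst d *\<^sub>R Wx n m s + fst (snd d) *\<^sub>R Wy n m s + snd (snd d) *\<^sub>R Wt n m s)) (at s)"
proof -
  obtain C where C: "\<And>d. norm d \<le> 1 \<Longrightarrow> cmod (W n m (s + d) - W n m s - DW n m s d) \<le> (norm d)\<^sup>2 * C"
    using W_remainder by blast
  have "(W n m has_derivative DW n m s) (at s)"
    unfolding has_derivative_at
  proof
    show "bounded_linear (DW n m s)"
      unfolding DW_eq[abs_def]
      by (intro bounded_linear_add bounded_linear_scaleR_const bounded_linear_fst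
          bounded_linear_snd bounded_linear_fst_comp bounded_linear_snd_comp)
    show "(\<lambda>d. norm (W n m (s + d) - W n m s - DW n m s d) / norm d) \<midarrow>0\<rightarrow> 0"
    proof (rule tendsto_0_le)
      show "((\<lambda>d. norm d) \<longlongrightarrow> 0) (at (0 :: real \<times> real \<times> real))"
        by (rule tendsto_norm_zero) (rule tendsto_ident_at)
      have "eventually (\<lambda>d :: real \<times> real \<times> real. norm d < 1) (at 0)"
        using eventually_at[of "\<lambda>d. norm d < 1" "0 :: real \<times> real \<times> real" UNIV] by (auto intro!: exI[of _ 1])
      then show "\<forall>\<^sub>F d in at 0. norm (norm (W n m (s + d) - W n m s - DW n m s d) / norm d) \<le> norm (norm d) * C"
      proof eventually_elim
        case (elim d)
        then show ?case
          using C[of d] by (cases "d = 0") (simp_all add: divide_le_eq power2_eq_square mult_ac)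
      qed
    qed
  qed
  then show ?thesis unfolding DW_eq[abs_def] .
qed

section \<open>The differential algebra generated by the functions \<open>W n m\<close>\<close>

inductive_set polyW :: "(real \<times> real \<times> real \<Rightarrow> complex) set" where
  polyW_W: "W n m \<in> polyW"
| polyW_const: "(\<lambda>_. c) \<in> polyW"
| polyW_add: "p \<in> polyW \<Longrightarrow> q \<in> polyW \<Longrightarrow> (\<lambda>s. p s + q s) \<in> polyW"
| polyW_mult: "p \<in> polyW \<Longrightarrow> q \<in> polyW \<Longrightarrow> (\<lambda>s. p s * q s) \<in> polyW"

lemma polyW_diff: "p \<in> polyW \<Longrightarrow> q \<in> polyW \<Longrightarrow> (\<lambda>s. p s - q s) \<in> polyW"
  using polyW_add[OF _ polyW_mult[OF polyW_const[of "- 1"]], of p q] by simp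

lemma polyW_uminus: "p \<in> polyW \<Longrightarrow> (\<lambda>s. - p s) \<in> polyW"
  using polyW_mult[OF polyW_const[of "- 1"], of p] by simp

lemmas polyW_intros [simp] = polyW.intros polyW_diff polyW_uminus

lemma Wx_polyW [simp]: "Wx n m \<in> polyW"
  and Wy_polyW [simp]: "Wy n m \<in> polyW"
  and Wt_polyW [simp]: "Wt n m \<in> polyW"
  unfolding Wx_def[abs_def] Wy_def[abs_def] Wt_def[abs_def] by simp_all

text \<open>The partial derivatives are given as functions on the whole parameter space, so that
  each can be asserted to lie in \<open>polyW\<close> and differentiated again.\<close>

definition gradient_at ::
  "(real \<times> real \<times> real \<Rightarrow> complex) \<Rightarrow> (real \<times> real \<times> real \<Rightarrow> complex) \<Rightarrow>
   (real \<times> real \<times> real \<Rightarrow> complex) \<Rightarrow> (real \<times> real \<times> real \<Rightarrow> complex) \<Rightarrow> real \<times> real \<times> real \<Rightarrow> bool" where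
  "gradient_at p a b c s \<longleftrightarrow>
     (p has_derivative (\<lambda>d. fst d *\<^sub>R a s + fst (snd d) *\<^sub>R b s + snd (snd d) *\<^sub>R c s)) (at s)"

lemma gradient_at_add:
  assumes "gradient_at p a b c s" "gradient_at q a' b' c' s"
  shows "gradient_at (\<lambda>s. p s + q s) (\<lambda>s. a s + a' s) (\<lambda>s. b s + b' s) (\<lambda>s. c s + c' s) s"
  using has_derivative_add[OF assms[unfolded gradient_at_def]] unfolding gradient_at_def
  by (rule has_derivative_eq_rhs) (simp add: fun_eq_iff algebra_simps)

lemma gradient_at_mult:
  assumes "gradient_at p a b c s" "gradient_at q a' b' c' s"
  shows "gradient_at (\<lambda>s. p s * q s) (\<lambda>s. p s * a' s + a s * q s) (\<lambda>s. p s * b' s + b s * q s)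
    (\<lambda>s. p s * c' s + c s * q s) s"
  using has_derivative_mult[OF assms[unfolded gradient_at_def]] unfolding gradient_at_def
  by (rule has_derivative_eq_rhs) (simp add: fun_eq_iff algebra_simps)

lemma gradient_at_W: "gradient_at (W n m) (Wx n m) (Wy n m) (Wt n m) s"
  unfolding gradient_at_def by (rule W_has_derivative)

lemma gradient_at_const: "gradient_at (\<lambda>_. z) (\<lambda>_. 0) (\<lambda>_. 0) (\<lambda>_. 0) s"
  unfolding gradient_at_def by simp

definition dx :: "(real \<times> real \<times> real \<Rightarrow> complex) \<Rightarrow> real \<times> real \<times> real \<Rightarrow> complex" where
  "dx p s = frechet_derivative p (at s) (1, 0, 0)"

definition dy :: "(real \<times> real \<times> real \<Rightarrow> complex) \<Rightarrow> real \<times> real \<times> real \<Rightarrow> complex" where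
  "dy p s = frechet_derivative p (at s) (0, 1, 0)"

definition dt :: "(real \<times> real \<times> real \<Rightarrow> complex) \<Rightarrow> real \<times> real \<times> real \<Rightarrow> complex" where
  "dt p s = frechet_derivative p (at s) (0, 0, 1)"

lemma gradient_at_partials:
  assumes "gradient_at p a b c s"
  shows "dx p s = a s" "dy p s = b s" "dt p s = c s"
  using frechet_derivative_at[OF assms[unfolded gradient_at_def], symmetric]
  by (simp_all add: dx_def dy_def dt_def)

lemma polyW_has_gradient:
  assumes "p \<in> polyW"
  shows "\<exists>a\<in>polyW. \<exists>b\<in>polyW. \<exists>c\<in>polyW. \<forall>s. gradient_at p a b c s"
  using assms
proof induction
  case (polyW_W n m)
  show ?case
    by (rule bexI[of _ "Wx n m"], rule bexI[of _ "Wy n m"], rule bexI[of _ "Wt n m"]) (simp_all add: gradient_at_W)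
next
  case (polyW_const z)
  show ?case
    by (rule bexI[of _ "\<lambda>_. 0"], rule bexI[of _ "\<lambda>_. 0"], rule bexI[of _ "\<lambda>_. 0"]) (simp_all add: gradient_at_const)
next
  case (polyW_add p q)
  from polyW_add.IH(1) obtain a b c where [simp]: "a \<in> polyW" "b \<in> polyW" "c \<in> polyW"
    and p: "\<And>s. gradient_at p a b c s" by blast
  from polyW_add.IH(2) obtain a' b' c' where [simp]: "a' \<in> polyW" "b' \<in> polyW" "c' \<in> polyW"
    and q: "\<And>s. gradient_at q a' b' c' s" by blast
  show ?case
    by (rule bexI[of _ "\<lambda>s. a s + a' s"], rule bexI[of _ "\<lambda>s. b s + b' s"], rule bexI[of _ "\<lambda>s. c s + c' s"],
        rule allI, rule gradient_at_add[OF p q]) simp_all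
next
  case (polyW_mult p q)
  from polyW_mult.IH(1) obtain a b c where [simp]: "a \<in> polyW" "b \<in> polyW" "c \<in> polyW"
    and p: "\<And>s. gradient_at p a b c s" by blast
  from polyW_mult.IH(2) obtain a' b' c' where [simp]: "a' \<in> polyW" "b' \<in> polyW" "c' \<in> polyW"
    and q: "\<And>s. gradient_at q a' b' c' s" by blast
  show ?case
    by (rule bexI[of _ "\<lambda>s. p s * a' s + a s * q s"], rule bexI[of _ "\<lambda>s. p s * b' s + b s * q s"],
        rule bexI[of _ "\<lambda>s. p s * c' s + c s * q s"], rule allI, rule gradient_at_mult[OF p q])
      (simp_all add: polyW_mult.hyps)
qed

lemma polyW_gradient:
  assumes "p \<in> polyW"
  shows "dx p \<in> polyW" "dy p \<in> polyW" "dt p \<in> polyW" "gradient_at p (dx p) (dy p) (dt p) s"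
proof -
  obtain a b c where abc: "a \<in> polyW" "b \<in> polyW" "c \<in> polyW" "\<And>s. gradient_at p a b c s"
    using polyW_has_gradient[OF assms] by blast
  have "dx p = a" "dy p = b" "dt p = c"
    by (rule ext, rule gradient_at_partials[OF abc(4)])+
  with abc show "dx p \<in> polyW" "dy p \<in> polyW" "dt p \<in> polyW" "gradient_at p (dx p) (dy p) (dt p) s" by simp_all
qed

text \<open>Every directional derivative is a constant-coefficient combination of
  \<open>dx p\<close>, \<open>dy p\<close> and \<open>dt p\<close>, hence again in
  \<open>polyW\<close>; induction on the order needs the claim for all \<open>p\<close>
  simultaneously.\<close>

lemma Ck_on_polyW: "p \<in> polyW \<Longrightarrow> Ck_on n UNIV p"
proof (induction n arbitrary: p)
  case 0
  have "isCont p s" for s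
    using polyW_gradient(4)[OF 0, of s] unfolding gradient_at_def by (rule has_derivative_continuous)
  then show ?case by (simp add: continuous_at_imp_continuous_on)
next
  case (Suc n)
  note g = polyW_gradient(4)[OF Suc.prems, unfolded gradient_at_def]
  have "(\<lambda>s. frechet_derivative p (at s) v)
      = (\<lambda>s. of_real (fst v) * dx p s + of_real (fst (snd v)) * dy p s + of_real (snd (snd v)) * dt p s)" for v
    unfolding frechet_derivative_at[OF g, symmetric] scaleR_conv_of_real by (rule refl)
  moreover have "p differentiable (at s)" for s
    using g differentiableI by blast
  ultimately show ?case
    using Suc by (simp add: polyW_gradient)
qed

lemma smooth_on_polyW: "p \<in> polyW \<Longrightarrow> smooth_on UNIV p"
  by (simp add: smooth_on_def Ck_on_polyW)

lemma partials_W: "dx (W n m) = Wx n m" "dy (W n m) = Wy n m" "dt (W n m) = Wt n m"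
  by (rule ext, rule gradient_at_partials[OF gradient_at_W])+

lemma partials_const: "dx (\<lambda>_. z) = (\<lambda>_. 0)" "dy (\<lambda>_. z) = (\<lambda>_. 0)" "dt (\<lambda>_. z) = (\<lambda>_. 0)"
  by (rule ext, rule gradient_at_partials[OF gradient_at_const])+

lemma partials_add:
  assumes "p \<in> polyW" "q \<in> polyW"
  shows "dx (\<lambda>s. p s + q s) = (\<lambda>s. dx p s + dx q s)"
    and "dy (\<lambda>s. p s + q s) = (\<lambda>s. dy p s + dy q s)"
    and "dt (\<lambda>s. p s + q s) = (\<lambda>s. dt p s + dt q s)"
  by (rule ext, rule gradient_at_partials[OF gradient_at_add[OF assms[THEN polyW_gradient(4)]]])+

lemma partials_mult:
  assumes "p \<in> polyW" "q \<in> polyW"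
  shows "dx (\<lambda>s. p s * q s) = (\<lambda>s. p s * dx q s + dx p s * q s)"
    and "dy (\<lambda>s. p s * q s) = (\<lambda>s. p s * dy q s + dy p s * q s)"
    and "dt (\<lambda>s. p s * q s) = (\<lambda>s. p s * dt q s + dt p s * q s)"
  by (rule ext, rule gradient_at_partials[OF gradient_at_mult[OF assms[THEN polyW_gradient(4)]]])+

lemma partials_uminus:
  assumes "p \<in> polyW"
  shows "dx (\<lambda>s. - p s) = (\<lambda>s. - dx p s)" "dy (\<lambda>s. - p s) = (\<lambda>s. - dy p s)" "dt (\<lambda>s. - p s) = (\<lambda>s. - dt p s)"
  using partials_mult[OF polyW_const[of "- 1"] assms] by (simp_all add: partials_const)

lemma partials_diff:
  assumes "p \<in> polyW" "q \<in> polyW"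
  shows "dx (\<lambda>s. p s - q s) = (\<lambda>s. dx p s - dx q s)"
    and "dy (\<lambda>s. p s - q s) = (\<lambda>s. dy p s - dy q s)"
    and "dt (\<lambda>s. p s - q s) = (\<lambda>s. dt p s - dt q s)"
  using partials_add[OF assms(1) polyW_uminus[OF assms(2)]] by (simp_all add: partials_uminus assms)

lemmas partials = partials_W partials_const partials_add partials_mult partials_uminus partials_diff

text \<open>The commutator of two derivations is a derivation, so it vanishes on the algebra as soon
  as it vanishes on the generators, where the formulas for \<open>Wx\<close> and \<open>Wy\<close>
  decide.\<close>

lemma partials_commute: "p \<in> polyW \<Longrightarrow> dx (dy p) = dy (dx p)"
proof (induction rule: polyW.induct)
  case (polyW_W n m)
  show ?case
    unfolding partials_W by (simp add: Wx_def[abs_def] Wy_def[abs_def] partials) (simp add: fun_eq_iff algebra_simps)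
qed (simp_all add: partials polyW_gradient fun_eq_iff)

text \<open>KP-I integrated once in \<open>x\<close>, for half the antiderivative of
  \<open>u\<close>. Repeated use of the three derivative formulas makes both sides polynomials in
  the \<open>W n m\<close>, and these coincide.\<close>

lemma potential_KP:
  "4 * dt (dx (W 0 0)) s + 12 * dx (W 0 0) s * dx (dx (W 0 0)) s + dx (dx (dx (dx (W 0 0)))) s
    = 3 * dy (dy (W 0 0)) s"
  by (simp add: partials Wx_def[abs_def] Wy_def[abs_def] Wt_def[abs_def]) (simp add: algebra_simps)

end

section \<open>The KP-I equation and the behaviour at infinity\<close>

context kp_measure begin

lemma polyW_has_vector_derivative:
  assumes "p \<in> polyW"
  shows "((\<lambda>r. p (r, y, t)) has_vector_derivative dx p (x, y, t)) (at x)"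
    and "((\<lambda>r. p (x, r, t)) has_vector_derivative dy p (x, y, t)) (at y)"
    and "((\<lambda>r. p (x, y, r)) has_vector_derivative dt p (x, y, t)) (at t)"
proof -
  note g = polyW_gradient(4)[OF assms, of "(x, y, t)", unfolded gradient_at_def]
  have "((\<lambda>r. (r, y, t)) has_derivative (\<lambda>h. (h, 0, 0))) (at x)"
    "((\<lambda>r. (x, r, t)) has_derivative (\<lambda>h. (0, h, 0))) (at y)"
    "((\<lambda>r. (x, y, r)) has_derivative (\<lambda>h. (0, 0, h))) (at t)"
    unfolding zero_prod_def[symmetric]
    by (intro has_derivative_Pair has_derivative_ident has_derivative_const)+
  from this[THEN has_derivative_compose, OF g]
  show "((\<lambda>r. p (r, y, t)) has_vector_derivative dx p (x, y, t)) (at x)"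
    "((\<lambda>r. p (x, r, t)) has_vector_derivative dy p (x, y, t)) (at y)"
    "((\<lambda>r. p (x, y, r)) has_vector_derivative dt p (x, y, t)) (at t)"
    unfolding has_vector_derivative_def by simp_all
qed

lemma Dx_polyW: "p \<in> polyW \<Longrightarrow> Dx (\<lambda>x y t. p (x, y, t)) = (\<lambda>x y t. dx p (x, y, t))"
  and Dy_polyW: "p \<in> polyW \<Longrightarrow> Dy (\<lambda>x y t. p (x, y, t)) = (\<lambda>x y t. dy p (x, y, t))"
  and Dt_polyW: "p \<in> polyW \<Longrightarrow> Dt (\<lambda>x y t. p (x, y, t)) = (\<lambda>x y t. dt p (x, y, t))"
  by (simp_all add: fun_eq_iff Dx_def Dy_def Dt_def vector_derivative_at[OF polyW_has_vector_derivative(1)]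
      vector_derivative_at[OF polyW_has_vector_derivative(2)] vector_derivative_at[OF polyW_has_vector_derivative(3)])

lemma KP_I_solution_W: "KP_I_solution (\<lambda>x y t. 2 * dx (W 0 0) (x, y, t))"
proof -
  define v where "v = W 0 0"
  define U where "U = (\<lambda>s. 2 * dx v s)"
  have v: "v \<in> polyW" by (simp add: v_def)
  note [simp] = polyW_gradient
  have U: "U \<in> polyW" by (simp add: U_def v)
  \<comment> \<open>The bracket under the outer \<open>x\<close>-derivative. It lies in
    \<open>polyW\<close>, and by \<open>potential_KP\<close> it is a multiple of
    \<open>dy (dy v)\<close>.\<close>
  define P where "P = (\<lambda>s. dt U s + 3 / 2 * U s * dx U s + 1 / 4 * dx (dx (dx U)) s)"
  have P: "P \<in> polyW" unfolding P_def by (intro polyW_intros polyW_gradient U)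
  have "P = (\<lambda>s. 3 / 2 * dy (dy v) s)"
  proof
    fix s
    have "P s = 1 / 2 * (4 * dt (dx v) s + 12 * dx v s * dx (dx v) s + dx (dx (dx (dx v))) s)"
      unfolding P_def U_def by (simp add: v partials del: partials_W)
    then show "P s = 3 / 2 * dy (dy v) s"
      unfolding v_def potential_KP by simp
  qed
  then have dxP: "dx P s = 3 / 2 * dx (dy (dy v)) s" for s
    by (simp only: partials_mult partials_const polyW_const polyW_gradient(2) v) simp
  \<comment> \<open>The equation ends in \<open>dy (dy U)\<close> with \<open>U = 2 * dx v\<close>,
    so the outer \<open>dx\<close> has to pass both \<open>dy\<close>.\<close>
  have comm: "dx (dy (dy v)) = dy (dy (dx v))"
    by (simp add: v partials_commute)
  have dP: "dx P s - 3 / 4 * dy (dy U) s = 0" for s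
    unfolding U_def dxP comm by (simp add: v partials)
  have "smooth_on UNIV (\<lambda>(x, y, t). U (x, y, t))"
    using smooth_on_polyW[OF U] by simp
  moreover have "Dx (\<lambda>x y t. Dt (\<lambda>x y t. U (x, y, t)) x y t
        + 3 / 2 * U (x, y, t) * Dx (\<lambda>x y t. U (x, y, t)) x y t
        + 1 / 4 * Dx (Dx (Dx (\<lambda>x y t. U (x, y, t)))) x y t) x y t
      - 3 / 4 * Dy (Dy (\<lambda>x y t. U (x, y, t))) x y t = 0" for x y t
  proof -
    have "(\<lambda>x y t. Dt (\<lambda>x y t. U (x, y, t)) x y t
        + 3 / 2 * U (x, y, t) * Dx (\<lambda>x y t. U (x, y, t)) x y t
        + 1 / 4 * Dx (Dx (Dx (\<lambda>x y t. U (x, y, t)))) x y t) = (\<lambda>x y t. P (x, y, t))"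
      by (simp add: P_def U Dx_polyW Dt_polyW)
    then show ?thesis
      using dP[of "(x, y, t)"] by (simp add: Dx_polyW Dy_polyW P U)
  qed
  ultimately show ?thesis
    unfolding KP_I_solution_def U_def v_def by blast
qed

text \<open>\<open>Wx 0 0\<close> is the sum of the conjugate pair \<open>W 1 0\<close>,
  \<open>W 0 1\<close> minus the square of the real function \<open>W 0 0\<close>.\<close>

lemma dx_W_real: "dx (W 0 0) s \<in> \<real>"
  by (simp add: partials Wx_def Reals_cnj_iff W_cnj)

section \<open>Decay as \<open>x\<close> tends to minus infinity\<close>

lemma W_tendsto_0: "((\<lambda>x. W n m (x, y, t)) \<longlongrightarrow> 0) at_bot"
proof (rule Lim_null_comparison)
  define C where "C n = L2norm N (rhs n (0, y, t))" for n
  have rhs: "L2norm N (rhs n (x, y, t)) \<le> exp (\<delta> * x) * C n" if "x \<le> 0" for x n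
    unfolding C_def
  proof (rule L2norm_bound)
    fix l assume l: "l \<in> space N"
    have "phase (x, y, t) l = of_real x * l + phase (0, y, t) l"
      by (simp add: phase_def)
    then have "cmod (wave (x, y, t) l) = exp (x * Re l) * cmod (wave (0, y, t) l)"
      by (simp add: cmod_wave exp_add)
    \<comment> \<open>Multiplying \<open>\<delta> \<le> Re l\<close> by \<open>x \<le> 0\<close>
      reverses the inequality, which gives a decay rate common to all \<open>l\<close>.\<close>
    also have "\<dots> \<le> exp (\<delta> * x) * cmod (wave (0, y, t) l)"
      using mult_left_mono_neg[OF Re_ge[OF l] that] by (intro mult_right_mono) (auto simp: mult.commute)
    finally have "cmod l ^ n * cmod (wave (x, y, t) l) \<le> cmod l ^ n * (exp (\<delta> * x) * cmod (wave (0, y, t) l))"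
      by (intro mult_left_mono) auto
    then show "cmod (rhs n (x, y, t) l) \<le> exp (\<delta> * x) * cmod (rhs n (0, y, t) l)"
      by (simp add: rhs_def norm_mult norm_power mult_ac)
  qed (simp_all add: moderate_measurable)
  show "\<forall>\<^sub>F x in at_bot. norm (W n m (x, y, t)) \<le> (exp (\<delta> * x) * C n) * (exp (\<delta> * x) * C m)"
    using eventually_le_at_bot[of 0]
  proof eventually_elim
    case (elim x)
    have "cmod (W n m (x, y, t)) \<le> L2norm N (rhs n (x, y, t)) * L2norm N (rhs m (x, y, t))"
      by (rule cmod_W_le)
    also have "\<dots> \<le> (exp (\<delta> * x) * C n) * (exp (\<delta> * x) * C m)"
      by (intro mult_mono rhs elim) (auto simp: C_def)
    finally show ?case .
  qed
  have "((\<lambda>x. exp (\<delta> * x)) \<longlongrightarrow> 0) at_bot"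
    by (rule filterlim_compose[OF exp_at_bot], rule filterlim_tendsto_pos_mult_at_bot[OF tendsto_const \<delta>_pos filterlim_ident])
  from tendsto_mult[OF tendsto_mult_left_zero[OF this] tendsto_mult_left_zero[OF this], of "C n" "C m"]
  show "((\<lambda>x. (exp (\<delta> * x) * C n) * (exp (\<delta> * x) * C m)) \<longlongrightarrow> 0) at_bot"
    by simp
qed

text \<open>The derivative is itself a polynomial in the \<open>W n m\<close> without constant term,
  so their decay carries over and no limit has to be differentiated.\<close>

lemma dx_W_tendsto_0: "((\<lambda>x. 2 * dx (W 0 0) (x, y, t)) \<longlongrightarrow> 0) at_bot"
proof -
  have "((\<lambda>x. 2 * (W 1 0 (x, y, t) + W 0 1 (x, y, t) - W 0 0 (x, y, t) * W 0 0 (x, y, t))) \<longlongrightarrow> 2 * (0 + 0 - 0 * 0)) at_bot"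
    by (intro tendsto_intros W_tendsto_0)
  then show ?thesis by (simp add: partials Wx_def)
qed

text \<open>Multiplying by the unimodular factor below turns the kernel of the integral equation into
  \<open>K (wave s)\<close>, and by symmetry the solution itself is not needed to evaluate the potential.\<close>

lemma W_unique:
  assumes \<psi>: "square_integrable N \<psi>"
    and eq: "AE k in N. \<psi> k + (\<integral>l. of_real (cmod (wave s k) * cmod (wave s l)) / (l + cnj k) * \<psi> l \<partial>N)
        = of_real (cmod (wave s k))"
  shows "(\<integral>l. of_real (cmod (wave s l)) * \<psi> l \<partial>N) = W 0 0 s"
proof -
  \<comment> \<open>Chosen so that \<open>wave s l * c l\<close> is the modulus of the wave.
    Conjugation gives \<open>cnj (wave s l) = c l * |wave s l|\<close>, so the same factor serves
    both variables of the kernel.\<close>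
  define c where "c l = exp (- \<i> * of_real (Im (phase s l)))" for l
  define \<phi> where "\<phi> l = c l * \<psi> l" for l
  have c [simp]: "cmod (c l) = 1" for l
    by (simp add: c_def)
  have wave: "wave s l * c l = of_real (cmod (wave s l))" for l
    unfolding wave_def c_def mult_exp_exp norm_exp_eq_Re exp_of_real[symmetric]
    by (rule arg_cong[where f = exp]) (simp add: complex_eq_iff)
  have cnj_wave: "cnj (wave s l) = c l * of_real (cmod (wave s l))" for l
  proof -
    have "cnj (c l) * c l = 1"
      using complex_norm_square[of "c l"] by (simp add: mult.commute)
    moreover have "cnj (wave s l) * cnj (c l) = of_real (cmod (wave s l))"
      using arg_cong[OF wave[of l], of cnj] by simp
    ultimately show ?thesis by (metis mult.assoc mult.commute mult_1_right)
  qed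
  have [measurable]: "c \<in> borel_measurable N" "\<psi> \<in> borel_measurable N"
    using moderate_measurable[OF moderate_phase] \<psi> unfolding c_def[abs_def] by measurable
  have \<phi>_meas [measurable]: "\<phi> \<in> borel_measurable N"
    unfolding \<phi>_def[abs_def] by measurable
  have \<phi>: "square_integrable N \<phi>"
    by (rule square_integrable_bound[OF \<psi> \<phi>_meas, of 1]) (simp add: \<phi>_def norm_mult)
  have A_\<phi>: "AE k in N. A (wave s) \<phi> k = rhs 0 s k"
    using eq
  proof eventually_elim
    case (elim k)
    have "T (\<lambda>l. wave s l * \<phi> l) k = (\<integral>l. of_real (cmod (wave s l)) / (l + cnj k) * \<psi> l \<partial>N)"
      unfolding T_def \<phi>_def wave[symmetric] by (simp add: mult_ac)
    then have "of_real (cmod (wave s k)) * T (\<lambda>l. wave s l * \<phi> l) k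
        = (\<integral>l. of_real (cmod (wave s k) * cmod (wave s l)) / (l + cnj k) * \<psi> l \<partial>N)"
      by (simp only: of_real_mult integral_mult_right_zero[symmetric] mult.assoc times_divide_eq_right[symmetric])
    then have "A (wave s) \<phi> k = c k * (\<psi> k + (\<integral>l. of_real (cmod (wave s k) * cmod (wave s l)) / (l + cnj k) * \<psi> l \<partial>N))"
      by (simp add: A_def K_def cnj_wave \<phi>_def algebra_simps)
    then show ?case
      unfolding elim by (simp add: rhs_def cnj_wave)
  qed
  have "(\<integral>l. of_real (cmod (wave s l)) * \<psi> l \<partial>N) = ip (rhs 0 s) \<phi>"
    by (simp add: ip_def rhs_def \<phi>_def wave[symmetric] mult.assoc)
  \<comment> \<open>\<open>rhs 0 s\<close> is \<open>A\<close> applied to \<open>sol 0 s\<close>.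
    Once \<open>A\<close> acts on \<open>\<phi>\<close>, the equation for \<open>\<phi>\<close> is
    used only under an integral, where its validity almost everywhere is enough.\<close>
  also have "\<dots> = ip (sol 0 s) (A (wave s) \<phi>)"
    using A_symmetric[of "wave s" "sol 0 s" \<phi>] \<phi> by (simp add: ip_A_sol_left)
  also have "\<dots> = ip (sol 0 s) (rhs 0 s)"
    unfolding ip_def
  proof (rule integral_cong_AE)
    show "AE l in N. cnj (sol 0 s l) * A (wave s) \<phi> l = cnj (sol 0 s l) * rhs 0 s l"
      using A_\<phi> by eventually_elim simp
  qed (use integrable_ip[OF sq_sol A_square_integrable[OF sq_wave \<phi>]] integrable_ip[OF sq_sol sq_rhs] in auto)
  finally show ?thesis by (simp add: W_eq)
qed

end

section \<open>From the domain and the weight to the measure \<open>N\<close>\<close>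

lemma weight_integrable:
  assumes domain: "admissible_domain \<Omega>" and weight: "admissible_weight \<Omega> g"
  shows "integrable (lebesgue_on \<Omega>) (\<lambda>l. exp (c * wt l) * g l)"
proof -
  have open_\<Omega>: "open \<Omega>" and Re_pos: "\<And>k. k \<in> \<Omega> \<Longrightarrow> 0 < Re k"
    using domain by (auto simp: admissible_domain_def)
  have sets [measurable]: "\<Omega> \<in> sets lebesgue" using open_\<Omega> by auto
  obtain U h where U: "open U" "closure \<Omega> \<subseteq> U" "smooth_on U h" "\<And>z. z \<in> closure \<Omega> \<Longrightarrow> g z = h z"
    using weight unfolding admissible_weight_def smooth_on_closed_def by blast
  have g_pos: "\<And>k. k \<in> closure \<Omega> \<Longrightarrow> 0 < g k"
    using weight by (simp add: admissible_weight_def)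
  have "Ck_on 0 U h" using U(3) unfolding smooth_on_def by blast
  then have "continuous_on U h" by simp
  then have "continuous_on (closure \<Omega>) h" using U(2) by (rule continuous_on_subset)
  then have g_cont: "continuous_on (closure \<Omega>) g" using U(4) by (metis continuous_on_cong)
  define F where "F = (\<lambda>c l. exp (c * wt l) * g l)"
  have F_cont: "continuous_on (closure \<Omega>) (F c)" for c
    unfolding F_def wt_def by (intro continuous_intros g_cont)
  have F_meas: "F c \<in> borel_measurable (lebesgue_on \<Omega>)" for c
    using continuous_on_subset[OF F_cont closure_subset] sets by (rule continuous_imp_measurable_on_sets_lebesgue)
  have "integrable (lebesgue_on \<Omega>) (F c)"
  proof (cases "bounded \<Omega>")
    case True
    then have "compact (F c ` closure \<Omega>)"
      by (intro compact_continuous_image F_cont) (simp add: compact_closure)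
    then obtain b where "\<And>l. l \<in> closure \<Omega> \<Longrightarrow> norm (F c l) \<le> b"
      using compact_imp_bounded bounded_iff by (metis imageI)
    then have b: "norm (F c l) \<le> b" if "l \<in> \<Omega>" for l
      using that closure_subset by blast
    have "\<Omega> \<in> lmeasurable" using True sets by (simp add: bounded_set_imp_lmeasurable)
    then interpret finite_measure "lebesgue_on \<Omega>" by (rule finite_measure_lebesgue_on)
    show ?thesis
      by (rule integrable_const_bound[of _ b]) (use b F_meas in \<open>auto intro!: AE_I2\<close>)
  next
    case False
    \<comment> \<open>The hypothesis speaks of positive exponents only; \<open>wt\<close> is
      nonnegative on the domain, so raising \<open>c\<close> to at least 1 can only enlarge the
      integrand.\<close>
    define c' where "c' = max c 1"
    have "integrable (lebesgue_on \<Omega>) (\<lambda>l. exp (c' * Re l * ((Re l)\<^sup>2 + (Im l)\<^sup>2)) * g l)"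
      using weight False by (auto simp: admissible_weight_def c'_def)
    then have int: "integrable (lebesgue_on \<Omega>) (F c')"
      by (simp add: F_def wt_def cmod_power2 mult.assoc)
    show ?thesis
    proof (rule Bochner_Integration.integrable_bound[OF int F_meas], rule AE_I2)
      fix l assume "l \<in> space (lebesgue_on \<Omega>)"
      then have l: "l \<in> \<Omega>" by simp
      then have "0 \<le> wt l" "0 < g l"
        using Re_pos[OF l] g_pos[of l] closure_subset by (auto simp: wt_def)
      then show "norm (F c l) \<le> norm (F c' l)"
        by (auto simp: F_def abs_mult c'_def intro!: mult_right_mono)
    qed
  qed
  then show ?thesis by (simp add: F_def)
qed

theorem lemma2p2:
  fixes \<Omega> :: "complex set"
    and g :: "complex \<Rightarrow> real"
    and \<psi> :: "real \<Rightarrow> real \<Rightarrow> real \<Rightarrow> complex \<Rightarrow> complex"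
    and u :: "real \<Rightarrow> real \<Rightarrow> real \<Rightarrow> complex"
  assumes domain: "admissible_domain \<Omega>"
    and weight: "admissible_weight \<Omega> g"
    and psi: "\<And>x y t. solves_integral_equation \<Omega> g x y t (\<psi> x y t)"
    and u: "\<And>x y t. u x y t = 2 * Dx (KP_potential \<Omega> g \<psi>) x y t"
  shows "(\<forall>x y t. (\<lambda>s. KP_potential \<Omega> g \<psi> s y t) differentiable (at x))
    \<and> KP_I_solution u
    \<and> (\<forall>x y t. u x y t \<in> \<real>)
    \<and> (\<forall>y t. ((\<lambda>x. u x y t) \<longlongrightarrow> 0) at_bot)"
proof -
  have open_\<Omega>: "open \<Omega>"
    using domain by (simp add: admissible_domain_def)
  have sets_\<Omega> [measurable]: "\<Omega> \<in> sets lebesgue" using open_\<Omega> by auto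
  have g_pos: "\<And>k. k \<in> \<Omega> \<Longrightarrow> 0 < g k"
    using weight closure_subset by (auto simp: admissible_weight_def)
  note int = weight_integrable[OF domain weight]
  have g_int: "integrable (lebesgue_on \<Omega>) g"
    using int[of 0] by simp
  then have g_meas [measurable]: "g \<in> borel_measurable (lebesgue_on \<Omega>)" by auto
  have g_AE: "AE k in lebesgue_on \<Omega>. 0 \<le> g k"
    using g_pos by (intro AE_I2) (auto intro: less_imp_le)
  have id_meas [measurable]: "(\<lambda>l. l) \<in> borel_measurable (lebesgue_on \<Omega>)"
    using sets_\<Omega> by (intro continuous_imp_measurable_on_sets_lebesgue continuous_intros)
  define N where "N = density (lebesgue_on \<Omega>) (\<lambda>l. ennreal (g l))"
  define \<delta> where "\<delta> = setdist \<Omega> {k. Re k = 0}"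
  have sp [simp]: "space N = \<Omega>" by (simp add: N_def)
  have meas_N: "borel_measurable N = borel_measurable (lebesgue_on \<Omega>)"
    unfolding N_def by (rule measurable_cong_sets) simp_all
  have "finite_measure N"
  proof (rule finite_measureI)
    have "emeasure N (space N) = (\<integral>\<^sup>+ l. ennreal (g l) * indicator \<Omega> l \<partial>lebesgue_on \<Omega>)"
      unfolding N_def by (subst emeasure_density) auto
    also have "\<dots> = (\<integral>\<^sup>+ l. ennreal (g l) \<partial>lebesgue_on \<Omega>)"
      by (intro nn_integral_cong) auto
    also have "\<dots> = ennreal (integral\<^sup>L (lebesgue_on \<Omega>) g)"
      by (rule nn_integral_eq_integral[OF g_int g_AE])
    finally show "emeasure N (space N) \<noteq> \<infinity>" by simp
  qed
  interpret kp_measure N \<delta>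
  proof (intro kp_measure.intro kp_measure_axioms.intro)
    show "finite_measure N" by fact
    show "(\<lambda>l. l) \<in> borel_measurable N" unfolding meas_N by (rule id_meas)
    show "0 < \<delta>" using domain by (simp add: admissible_domain_def \<delta>_def)
    show "\<delta> \<le> Re l" if "l \<in> space N" for l
    proof -
      \<comment> \<open>The orthogonal projection of \<open>l\<close> to the imaginary axis lies at
        distance \<open>Re l\<close>.\<close>
      have "\<delta> \<le> dist l (Complex 0 (Im l))"
        unfolding \<delta>_def using that by (intro setdist_le_dist) auto
      also have "\<dots> = Re l"
      proof -
        have "l - Complex 0 (Im l) = of_real (Re l)" by (simp add: complex_eq_iff)
        moreover have "0 < Re l" using domain that by (simp add: admissible_domain_def)
        ultimately show ?thesis by (simp add: dist_norm del: of_real_Re)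
      qed
      finally show ?thesis .
    qed
    have "(\<lambda>l. exp (c * wt l)) \<in> borel_measurable (lebesgue_on \<Omega>)" for c
      unfolding wt_def by measurable
    then show "integrable N (\<lambda>l. exp (c * wt l))" for c
      unfolding N_def using int[of c] g_AE by (simp add: integrable_density mult.commute)
  qed
  have E_eq: "E k x y t = cmod (wave (x, y, t) k)" for k x y t
    unfolding cmod_wave E_def phase_def
    by (simp add: power2_eq_square power3_eq_cube algebra_simps)
  have potential: "KP_potential \<Omega> g \<psi> x y t = W 0 0 (x, y, t)" for x y t
  proof -
    let ?s = "(x, y, t)" and ?\<psi> = "\<psi> x y t"
    have \<psi>_meas [measurable]: "?\<psi> \<in> borel_measurable (lebesgue_on \<Omega>)"
      and \<psi>_int: "integrable (lebesgue_on \<Omega>) (\<lambda>k. (cmod (?\<psi> k))\<^sup>2 * g k)"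
      and \<psi>_eq: "AE k in lebesgue_on \<Omega>.
        ?\<psi> k + (LINT l|lebesgue_on \<Omega>. complex_of_real (E k x y t * E l x y t) / (l + cnj k) * ?\<psi> l * complex_of_real (g l))
          = complex_of_real (E k x y t)"
      using psi[of x y t] by (auto simp: solves_integral_equation_def in_L2_def)
    have wave_meas [measurable]: "wave ?s \<in> borel_measurable (lebesgue_on \<Omega>)"
      using wave_measurable[of ?s] unfolding meas_N .
    have sq: "square_integrable N ?\<psi>"
      unfolding square_integrable_def meas_N
    proof
      show "integrable N (\<lambda>k. (cmod (?\<psi> k))\<^sup>2)"
        unfolding N_def using \<psi>_int g_AE by (subst integrable_density) (auto simp: mult.commute)
    qed measurable
    have int_N: "integral\<^sup>L N f = (\<integral>l. f l * complex_of_real (g l) \<partial>lebesgue_on \<Omega>)"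
      if "f \<in> borel_measurable (lebesgue_on \<Omega>)" for f
      unfolding N_def using integral_density[OF that g_meas g_AE]
      by (simp add: scaleR_conv_of_real mult.commute)
    have eq: "AE k in N. ?\<psi> k + (\<integral>l. complex_of_real (cmod (wave ?s k) * cmod (wave ?s l)) / (l + cnj k) * ?\<psi> l \<partial>N)
        = complex_of_real (cmod (wave ?s k))"
      unfolding N_def
    proof (subst AE_density)
      show "AE k in lebesgue_on \<Omega>. 0 < ennreal (g k) \<longrightarrow>
          ?\<psi> k + (\<integral>l. complex_of_real (cmod (wave ?s k) * cmod (wave ?s l)) / (l + cnj k) * ?\<psi> l
              \<partial>density (lebesgue_on \<Omega>) (\<lambda>l. ennreal (g l))) = complex_of_real (cmod (wave ?s k))"
        using \<psi>_eq unfolding N_def[symmetric]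
      proof eventually_elim
        case (elim k)
        have "(\<lambda>l. complex_of_real (cmod (wave ?s k) * cmod (wave ?s l)) / (l + cnj k) * ?\<psi> l) \<in> borel_measurable (lebesgue_on \<Omega>)"
          by measurable
        from int_N[OF this] elim show ?case by (simp add: E_eq)
      qed
    qed measurable
    have "KP_potential \<Omega> g \<psi> x y t = (\<integral>l. complex_of_real (cmod (wave ?s l)) * ?\<psi> l \<partial>N)"
      unfolding KP_potential_def E_eq by (rule int_N[symmetric]) measurable
    also have "\<dots> = W 0 0 ?s"
      by (rule W_unique[OF sq eq])
    finally show ?thesis .
  qed
  then have potential': "KP_potential \<Omega> g \<psi> = (\<lambda>x y t. W 0 0 (x, y, t))"
    by (simp add: fun_eq_iff)
  have u_eq: "u = (\<lambda>x y t. 2 * dx (W 0 0) (x, y, t))"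
    by (simp add: fun_eq_iff u potential' Dx_polyW)
  have "(\<lambda>s. KP_potential \<Omega> g \<psi> s y t) differentiable (at x)" for x y t
    unfolding potential' using polyW_has_vector_derivative(1)[OF polyW_W]
    by (rule differentiableI_vector)
  then show ?thesis
    unfolding u_eq using KP_I_solution_W dx_W_real dx_W_tendsto_0 by (auto intro: Reals_mult)
qed

end
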